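(* Let $(V,B)$ be a Steiner system of type $S(t,n,v)$, where $t<n\le v$, let $C=C_{(n,v)}\setminus B$, and let $X_C\subset\mathbb P^n$ be the Complement of the Steiner configuration of points with respect to a collection $\mathcal H=\{H_1,\dots,H_v\}$ of distinct hyperplanes of $\mathbb P^n$ any $n$ of which meet in a point. Then: (i) $\alpha(I_{X_C})=v-n$; (ii) $\alpha(I_{X_C}^{(q)})=v-n+q$ for $2\le q<n$; (iii) $\alpha(I_{X_C}^{(m)})=\alpha(I_{X_C}^{(q)})+pv$, where $m=pn+q$ and $0\le q<n$, and $\alpha(I_{X_C}^{(n)})=\alpha(I_{X_C}^{(0)})+v=v$.
   Context: A Steiner system $(V,B)$ of type $S(t,n,v)$ consists of a set $V=\{1,\dots,v\}$ and a collection $B$ of $n$-subsets of $V$ (blocks) such that every $t$-subset of $V$ is contained in a unique block. $C_{(n,v)}$ denotes the set of all $n$-subsets of $V$. Let $H_j$ be defined by the linear form $\ell_j$ over the field $k$. For an $n$-subset $\sigma$ of $V$ put $P_\sigma=\bigcap_{i\in\sigma}H_i$, a point with ideal $I_{P_\sigma}=(\ell_i:i\in\sigma)\subseteq k[x_0,\dots,x_n]$. Then $X_C=\{P_\sigma:\sigma\in C\}$, $I_{X_C}=\bigcap_{\sigma\in C}I_{P_\sigma}$, and $I_{X_C}^{(m)}=\bigcap_{\sigma\in C}I_{P_\sigma}^m$ is the $m$-th symbolic power, with $I_{X_C}^{(0)}=k[x_0,\dots,x_n]$. For a homogeneous ideal $I$, $\alpha(I)$ is the minimum integer $d$ such that the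 degree-$d$ part $I_d\ne 0$.
   Formalization: Added: t≥1; C is non-empty (so v≠n); and the points P_σ are pairwise distinct (no n+1 hyperplanes concurrent). Without these the claim fails, e.g. four concurrent lines in P^2 with t=1, or v=n where X_C is empty. *)

theory Defs
  imports
    "HOL-Library.Poly_Mapping"
    "HOL-Algebra.Ideal_Product"
begin

section \<open>Steiner systems\<close>

definition subsets_of_size :: "nat \<Rightarrow> nat \<Rightarrow> nat set set" where
  "subsets_of_size r v = {\<sigma>. \<sigma> \<subseteq> {1..v} \<and> card \<sigma> = r}"

definition steiner_system :: "nat \<Rightarrow> nat \<Rightarrow> nat \<Rightarrow> nat set set \<Rightarrow> bool" where
  "steiner_system t n v B \<longleftrightarrow>
     B \<subseteq> subsets_of_size n v \<and>
     (\<forall>T \<in> subsets_of_size t v. \<exists>!\<beta>. \<beta> \<in> B \<and> T \<subseteq> \<beta>)"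


section \<open>The polynomial ring in the variables $x_0,\dots,x_n$\<close>

text \<open>
  Polynomials are finitely supported functions from exponent vectors to coefficients; their
  product is the convolution provided by the theory \<^theory>\<open>HOL-Library.Poly_Mapping\<close>.
\<close>

type_synonym 'k mpoly = "(nat \<Rightarrow>\<^sub>0 nat) \<Rightarrow>\<^sub>0 'k"

definition poly_ring :: "nat \<Rightarrow> 'k::field mpoly ring" where
  "poly_ring n =
     \<lparr>carrier = {p. \<forall>a \<in> Poly_Mapping.keys p. Poly_Mapping.keys a \<subseteq> {0..n}},
      mult = (*), one = 1, zero = 0, add = (+)\<rparr>"

definition monomial_degree :: "(nat \<Rightarrow>\<^sub>0 nat) \<Rightarrow> nat" where
  "monomial_degree a = (\<Sum>i \<in> Poly_Mapping.keys a. Poly_Mapping.lookup a i)"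

definition homogeneous_of_degree :: "nat \<Rightarrow> 'k::field mpoly \<Rightarrow> bool" where
  "homogeneous_of_degree d p \<longleftrightarrow> (\<forall>a \<in> Poly_Mapping.keys p. monomial_degree a = d)"

definition poly_eval :: "'k::field mpoly \<Rightarrow> (nat \<Rightarrow> 'k) \<Rightarrow> 'k" where
  "poly_eval p x =
     (\<Sum>a \<in> Poly_Mapping.keys p. Poly_Mapping.lookup p a *
        (\<Prod>i \<in> Poly_Mapping.keys a. x i ^ Poly_Mapping.lookup a i))"

text \<open>A linear form is required to be nonzero, since it has to define a hyperplane.\<close>

definition linear_form :: "nat \<Rightarrow> 'k::field mpoly \<Rightarrow> bool" where
  "linear_form n l \<longleftrightarrow>
     l \<in> carrier (poly_ring n) \<and> homogeneous_of_degree 1 l \<and> l \<noteq> 0"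

text \<open>The least degree of a nonzero form in a nonzero homogeneous ideal.\<close>

definition alpha :: "'k::field mpoly set \<Rightarrow> nat" where
  "alpha I = (LEAST d. \<exists>p \<in> I. p \<noteq> 0 \<and> homogeneous_of_degree d p)"

lemma cring_poly_ring: "cring (poly_ring n :: 'k::field mpoly ring)"
proof -
  have inv: "\<exists>q \<in> carrier (poly_ring n). q + p = 0"
    if "p \<in> carrier (poly_ring n)" for p :: "'k mpoly"
    using that by (intro bexI[of _ "- p"]) (auto simp: poly_ring_def)
  have "abelian_group (poly_ring n :: 'k mpoly ring)"
  proof (rule abelian_groupI)
    fix p q :: "'k mpoly"
    assume "p \<in> carrier (poly_ring n)" "q \<in> carrier (poly_ring n)"
    then show "p \<oplus>\<^bsub>poly_ring n\<^esub> q \<in> carrier (poly_ring n)"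
      using Poly_Mapping.keys_add[of p q] by (auto simp: poly_ring_def)
  qed (use inv in \<open>auto simp: poly_ring_def add_ac\<close>)
  moreover have "comm_monoid (poly_ring n :: 'k mpoly ring)"
  proof (rule comm_monoidI)
    fix p q :: "'k mpoly"
    assume "p \<in> carrier (poly_ring n)" "q \<in> carrier (poly_ring n)"
    then show "p \<otimes>\<^bsub>poly_ring n\<^esub> q \<in> carrier (poly_ring n)"
      by (auto simp: poly_ring_def dest!: subsetD[OF Poly_Mapping.keys_mult]
          subsetD[OF Poly_Mapping.keys_add])
  qed (auto simp: poly_ring_def mult_ac)
  ultimately show ?thesis
    by (rule cringI) (simp add: poly_ring_def distrib_right)
qed


section \<open>Projective space and hyperplanes\<close>

text \<open>
  Points of the $n$-dimensional projective space are classes of nonzero coordinate vectors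
  $(x_0,\dots,x_n)$ modulo scaling; coordinate vectors are functions vanishing beyond $n$.
\<close>

definition proj_space :: "nat \<Rightarrow> (nat \<Rightarrow> 'k::field) set set" where
  "proj_space n =
     (\<lambda>x. {(\<lambda>i. c * x i) | c. c \<noteq> 0}) ` {x. (\<forall>i > n. x i = 0) \<and> (\<exists>i. x i \<noteq> 0)}"

definition hyperplane :: "nat \<Rightarrow> 'k::field mpoly \<Rightarrow> (nat \<Rightarrow> 'k) set set" where
  "hyperplane n l = {P \<in> proj_space n. \<forall>x \<in> P. poly_eval l x = 0}"

text \<open>
  Any $n$ of the hyperplanes meet in a point $P_\sigma$, and the points $P_\sigma$ for different
  $\sigma$ are different; the latter says that no $n+1$ of the hyperplanes have a common point.
\<close>

definition proper_hyperplanes ::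
    "nat \<Rightarrow> nat \<Rightarrow> (nat \<Rightarrow> 'k::field mpoly) \<Rightarrow> (nat \<Rightarrow> (nat \<Rightarrow> 'k) set set) \<Rightarrow> bool" where
  "proper_hyperplanes n v \<l> H \<longleftrightarrow>
     (\<forall>j \<in> {1..v}. linear_form n (\<l> j) \<and> H j = hyperplane n (\<l> j)) \<and>
     inj_on H {1..v} \<and>
     (\<forall>\<sigma> \<in> subsets_of_size n v. \<exists>P. (\<Inter>i\<in>\<sigma>. H i) = {P}) \<and>
     inj_on (\<lambda>\<sigma>. \<Inter>i\<in>\<sigma>. H i) (subsets_of_size n v)"


section \<open>Ideals of configurations of points and their symbolic powers\<close>

definition point_ideal :: "nat \<Rightarrow> (nat \<Rightarrow> 'k::field mpoly) \<Rightarrow> nat set \<Rightarrow> 'k mpoly set" where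
  "point_ideal n \<l> \<sigma> = genideal (poly_ring n) (\<l> ` \<sigma>)"

text \<open>
  The intersection with the carrier only matters for an empty configuration, whose ideal
  is the whole ring.
\<close>

definition config_ideal :: "nat \<Rightarrow> (nat \<Rightarrow> 'k::field mpoly) \<Rightarrow> nat set set \<Rightarrow> 'k mpoly set" where
  "config_ideal n \<l> C = carrier (poly_ring n) \<inter> (\<Inter>\<sigma>\<in>C. point_ideal n \<l> \<sigma>)"

text \<open>Powers of ideals are taken in the multiplicative monoid \<^const>\<open>ideals_set\<close> of ideals.\<close>

definition symbolic_power ::
    "nat \<Rightarrow> (nat \<Rightarrow> 'k::field mpoly) \<Rightarrow> nat set set \<Rightarrow> nat \<Rightarrow> 'k mpoly set" where
  "symbolic_power n \<l> C m =
     carrier (poly_ring n) \<inter>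
     (\<Inter>\<sigma>\<in>C. point_ideal n \<l> \<sigma> [^]\<^bsub>ideals_set (poly_ring n)\<^esub> m)"

end

theory Submission
  imports Defs "HOL-Computational_Algebra.Polynomial"
begin

text \<open>
  Upper bounds come from products of the \<open>\<l> j\<close>: the form \<open>\<Prod>j. \<l> j ^ k j\<close> lies in the power of
  \<open>I_{P_\<sigma>}\<close> with exponent \<open>\<Sum>j\<in>\<sigma>. k j\<close>. One takes every form \<open>p\<close> times, and once more the forms outside
  a block if \<open>q = 1\<close>, or any \<open>v - n + q\<close> forms if \<open>q \<ge> 2\<close>.

  For the lower bounds let \<open>F\<close> vanish to order \<open>m\<close> at the points of the complement. On a hyperplane
  \<open>H j\<close>, which has dimension \<open>n - 1\<close>, the other hyperplanes cut out a configuration of the same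
  kind: the only property of the blocks that matters is that an \<open>(n - 1)\<close>-set lies in at most one
  block, and it passes to the derived system, as does the difference \<open>v - n \<ge> 2\<close>. If the degree of \<open>F\<close>
  is below the bound, then by induction on \<open>n\<close> it vanishes on every \<open>H j\<close>; it is thus divisible by
  all \<open>\<l> j\<close>, and the quotient has degree smaller by \<open>v\<close> and order at least \<open>m - n\<close>, so that induction
  on \<open>m\<close> applies. Since \<open>k\<close> may be finite, forms are treated as functions on vectors over the
  infinite domain \<open>k[X]\<close>.
\<close>

section \<open>Forms as polynomial functions\<close>

lemma infinite_UNIV_poly: "infinite (UNIV :: 'k::comm_ring_1 poly set)"
proof
  assume "finite (UNIV :: 'k poly set)"
  then have "finite (range (monom (1::'k)))"
    by (rule rev_finite_subset) simp
  moreover have "inj (monom (1::'k))"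
    by (rule injI) (metis degree_monom_eq zero_neq_one)
  ultimately show False
    using finite_imageD infinite_UNIV_nat by blast
qed

text \<open>The point s = 0 is left out so that a factor s can be cancelled before two polynomial
  functions are compared.\<close>

lemma poly_eqI_nonzero:
  fixes p q :: "'a::idom poly"
  assumes "infinite (UNIV :: 'a set)" "\<And>s. s \<noteq> 0 \<Longrightarrow> poly p s = poly q s"
  shows "p = q"
proof (rule ccontr)
  assume "p \<noteq> q"
  then have "finite {s. poly (p - q) s = 0}"
    by (intro poly_roots_finite) simp
  moreover have "UNIV \<subseteq> insert 0 {s. poly (p - q) s = 0}"
    using assms(2) by auto
  ultimately show False
    using assms(1) by (meson finite_insert finite_subset)
qed

text \<open>A form is represented by the function that it induces, so that restricting it to a
  subspace or composing it with a linear map needs no substitution. The degree is an index of the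
  relation because the zero function is a form of every degree.\<close>

inductive form :: "nat \<Rightarrow> ((nat \<Rightarrow> 'a::idom) \<Rightarrow> 'a) \<Rightarrow> bool" where
  const: "form 0 (\<lambda>x. c)"
| add: "form d F \<Longrightarrow> form d G \<Longrightarrow> form d (\<lambda>x. F x + G x)"
| coord: "form d F \<Longrightarrow> form (Suc d) (\<lambda>x. x i * F x)"

lemma form_zero: "form d (\<lambda>x. 0)"
proof (induction d)
  case 0
  show ?case by (rule form.const)
next
  case (Suc d)
  then show ?case using form.coord[OF Suc] by simp
qed

lemma form_smult: "form d F \<Longrightarrow> form d (\<lambda>x. c * F x)"
proof (induction rule: form.induct)
  case (const c')
  show ?case by (rule form.const)
next
  case (add d F G)
  then show ?case using form.add by (simp add: distrib_left)
next
  case (coord d F i)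
  then show ?case using form.coord[OF coord.IH, of i] by (simp add: ac_simps)
qed

lemma form_mult: "form d F \<Longrightarrow> form e G \<Longrightarrow> form (d + e) (\<lambda>x. F x * G x)"
proof (induction rule: form.induct)
  case (const c)
  then show ?case using form_smult by simp
next
  case (add d F F')
  then show ?case using form.add by (simp add: distrib_right)
next
  case (coord d F i)
  then show ?case using form.coord[of "d + e" "\<lambda>x. F x * G x" i] by (simp add: mult.assoc)
qed

lemma form_sum: "(\<And>a. a \<in> A \<Longrightarrow> form d (F a)) \<Longrightarrow> form d (\<lambda>x. \<Sum>a\<in>A. F a x)"
  by (induction A rule: infinite_finite_induct) (auto intro: form_zero form.add)

lemma form_coord: "form 1 (\<lambda>x. x i)"
  using form.coord[OF form.const, of i 1] by simp

lemma form_compose: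
  assumes "form d F" "\<And>i. form 1 (\<lambda>x. T x i)"
  shows "form d (\<lambda>x. F (T x))"
  using assms(1)
proof (induction rule: form.induct)
  case (coord d F i)
  then show ?case using form_mult[OF assms(2)[of i]] by simp
qed (auto intro: form.intros)

lemma form_homogeneous: "form d F \<Longrightarrow> F (\<lambda>i. c * x i) = c ^ d * F x"
  by (induction rule: form.induct) (auto simp: algebra_simps)

lemma form_0_const: "form 0 F \<Longrightarrow> F x = F y"
  using form_homogeneous[of 0 F 0 x] form_homogeneous[of 0 F 0 y] by simp

text \<open>If \<open>l w = 1\<close>, then \<open>T\<close> is the projection along \<open>w\<close> onto the kernel of \<open>l\<close>.\<close>

lemma form_decompose:
  assumes "form d F" "form 1 l" and T: "T = (\<lambda>x i. x i - l x * w i)"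
  shows "d = Suc e \<Longrightarrow> \<exists>G. form e G \<and> (\<forall>x. F x = F (T x) + l x * G x)"
  using assms(1)
proof (induction arbitrary: e rule: form.induct)
  case (const c)
  then show ?case by simp
next
  case (add d F F')
  from add.IH(1)[OF add.prems] obtain G where G: "form e G" "\<And>x. F x = F (T x) + l x * G x"
    by blast
  from add.IH(2)[OF add.prems] obtain G' where G': "form e G'" "\<And>x. F' x = F' (T x) + l x * G' x"
    by blast
  have "F x + F' x = F (T x) + F' (T x) + l x * (G x + G' x)" for x
    unfolding G(2)[of x] G'(2)[of x] by (simp add: algebra_simps)
  with form.add[OF G(1) G'(1)] show ?case by blast
next
  case (coord d F i)
  have T1: "form 1 (\<lambda>x. T x i)" for i
    using form.add[OF form_coord form_smult[OF assms(2), of "- w i"]]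
    by (simp add: T algebra_simps)
  have FT: "form e (\<lambda>x. w i * F (T x))"
    using coord.prems form_smult[OF form_compose[OF coord.hyps T1], of "w i"] by simp
  show ?case
  proof (cases e)
    case 0
    then have "F x = F (T x)" for x
      using coord form_0_const by blast
    then have "x i * F x = T x i * F (T x) + l x * (w i * F (T x))" for x
      by (subst \<open>F x = F (T x)\<close>) (simp add: T algebra_simps)
    with FT show ?thesis by blast
  next
    case (Suc e')
    then obtain G where G: "form e' G" "\<And>x. F x = F (T x) + l x * G x"
      using coord by auto
    \<comment> \<open>Expanding x_i F(x) by x_i = (T x)_i + l(x) w_i and F(x) = F(T x) + l(x) G(x)
      makes this the cofactor of l(x).\<close>
    have "form e (\<lambda>x. x i * G x + w i * F (T x))"
      using G(1) FT Suc by (auto intro: form.intros)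
    moreover have "x i * F x = T x i * F (T x) + l x * (x i * G x + w i * F (T x))" for x
      using arg_cong[OF G(2), of "\<lambda>t. x i * t" x] by (simp add: T algebra_simps)
    ultimately show ?thesis by blast
  qed
qed

text \<open>\<open>Q\<close> is a polynomial in s whose coefficients are polynomials in u, so each
  coefficient of the restriction to the line in direction y + u w varies polynomially with u. This
  permits the passage from nonzero u to u = 0.\<close>

lemma form_on_plane:
  assumes "form d F"
  shows "\<exists>Q. \<forall>u s. F (\<lambda>i. x i + s * (y i + u * w i)) = poly (map_poly (\<lambda>q. poly q u) Q) s"
  using assms
proof (induction rule: form.induct)
  case (const c)
  show ?case by (rule exI[of _ "[:[:c:]:]"]) (simp add: map_poly_pCons)
next
  case (add d F G)
  then obtain Q Q' where
    "\<forall>u s. F (\<lambda>i. x i + s * (y i + u * w i)) = poly (map_poly (\<lambda>q. poly q u) Q) s"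
    "\<forall>u s. G (\<lambda>i. x i + s * (y i + u * w i)) = poly (map_poly (\<lambda>q. poly q u) Q') s"
    by blast
  moreover have "map_poly (\<lambda>q. poly q u) (Q + Q') =
      map_poly (\<lambda>q. poly q u) Q + map_poly (\<lambda>q. poly q u) Q'" for u
    by (rule poly_eqI) (simp add: coeff_map_poly)
  ultimately show ?case
    by (intro exI[of _ "Q + Q'"]) simp
next
  case (coord d F i)
  then obtain Q where Q:
    "\<forall>u s. F (\<lambda>i. x i + s * (y i + u * w i)) = poly (map_poly (\<lambda>q. poly q u) Q) s"
    by blast
  have "map_poly (\<lambda>q. poly q u) ([:[:x i:], [:y i, w i:]:] * Q) =
      [:x i, y i + u * w i:] * map_poly (\<lambda>q. poly q u) Q" for u
    by (rule poly_eqI) (auto simp: coeff_map_poly coeff_pCons algebra_simps split: nat.split)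
  with Q show ?case
    by (intro exI[of _ "[:[:x i:], [:y i, w i:]:] * Q"]) (simp add: algebra_simps)
qed

lemma form_on_line:
  assumes "form d F"
  shows "\<exists>p. \<forall>s. F (\<lambda>i. x i + s * y i) = poly p s"
proof -
  obtain Q where "\<forall>u s. F (\<lambda>i. x i + s * (y i + u * 0)) = poly (map_poly (\<lambda>q. poly q u) Q) s"
    using form_on_plane[OF assms, of x y "\<lambda>_. 0"] by blast
  then show ?thesis by simp blast
qed

text \<open>The order is tested on every line through \<open>a\<close> with direction in
  \<open>W\<close>, as divisibility by s^m. This avoids derivatives, which lose information in
  positive characteristic, and passes at once to a smaller \<open>W\<close>.\<close>

definition vanishes_to_order ::
    "nat \<Rightarrow> ((nat \<Rightarrow> 'a::idom) \<Rightarrow> 'a) \<Rightarrow> (nat \<Rightarrow> 'a) set \<Rightarrow> (nat \<Rightarrow> 'a) \<Rightarrow> bool" where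
  "vanishes_to_order m F W a \<longleftrightarrow>
     (\<forall>y\<in>W. \<exists>p. (\<forall>s. F (\<lambda>i. a i + s * y i) = poly p s) \<and> monom 1 m dvd p)"

lemma vanishes_to_order_subset:
  "vanishes_to_order m F W a \<Longrightarrow> W' \<subseteq> W \<Longrightarrow> vanishes_to_order m F W' a"
  by (auto simp: vanishes_to_order_def)

text \<open>Along a direction y the factor l becomes l(a) + s l(y). Its order at s = 0 is 1 if l(a)
  = 0 and l(y) is nonzero, and 0 if l(a) is nonzero; this is subtracted from the order of F. The
  vector w serves to reach the directions with l(a) = l(y) = 0.\<close>

lemma vanishes_to_order_quotient:
  fixes F G l :: "(nat \<Rightarrow> 'a::idom) \<Rightarrow> 'a"
  assumes inf: "infinite (UNIV :: 'a set)"
    and G: "form d G"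
    and F: "vanishes_to_order m F W a" "\<And>x. x \<in> W \<Longrightarrow> F x = l x * G x"
    and lin: "\<And>x y s. l (\<lambda>i. x i + s * y i) = l x + s * l y"
    and W: "\<And>x y s. x \<in> W \<Longrightarrow> y \<in> W \<Longrightarrow> (\<lambda>i. x i + s * y i) \<in> W"
    and "a \<in> W" and w: "w \<in> W" "l w \<noteq> 0"
  shows "vanishes_to_order (if l a = 0 then m - 1 else m) G W a"
proof -
  define m' where "m' = (if l a = 0 then m - 1 else m)"
  have line: "monom 1 m dvd [:l a, l y:] * q"
    if y: "y \<in> W" and q: "\<And>s. G (\<lambda>i. a i + s * y i) = poly q s" for y q
  proof -
    obtain p where p: "\<forall>s. F (\<lambda>i. a i + s * y i) = poly p s" "monom 1 m dvd p"
      using F(1) y by (auto simp: vanishes_to_order_def)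
    have "poly p s = poly ([:l a, l y:] * q) s" for s
      using p(1) F(2)[OF W[OF \<open>a \<in> W\<close> y, of s]] lin[of a s y] q[of s]
      by (simp add: algebra_simps)
    then have "p = [:l a, l y:] * q"
      by (rule poly_eqI_nonzero[OF inf])
    with p(2) show ?thesis by (simp only:)
  qed
  have gen: "monom 1 m' dvd q"
    if y: "y \<in> W" "l a \<noteq> 0 \<or> l y \<noteq> 0"
      and q: "\<And>s. G (\<lambda>i. a i + s * y i) = poly q s" for y q
  proof (cases "q = 0")
    case False
    have ne: "[:l a, l y:] * q \<noteq> 0"
      unfolding mult_eq_0_iff using False y(2) by auto
    have le: "m \<le> order 0 [:l a, l y:] + order 0 q"
      using line[OF y(1) q] unfolding monom_1_dvd_iff[OF ne] order_mult[OF ne] .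
    have "order 0 [:l a, l y:] = (if l a = 0 then 1 else 0)"
    proof (cases "l a = 0")
      case True
      then have eq: "[:l a, l y:] = smult (l y) ([:- 0, 1:] ^ 1)" by simp
      have "order 0 [:l a, l y:] = 1"
        unfolding eq using True y(2) by (subst order_smult) (simp, rule order_power_n_n)
      then show ?thesis using True by simp
    qed (simp add: order_0I)
    with le have "m' \<le> order 0 q"
      by (cases "l a = 0") (simp_all add: m'_def)
    then show ?thesis
      by (rule iffD2[OF monom_1_dvd_iff[OF False]])
  qed simp
  have "\<exists>p. (\<forall>s. G (\<lambda>i. a i + s * y i) = poly p s) \<and> monom 1 m' dvd p" if y: "y \<in> W" for y
  proof (cases "l a \<noteq> 0 \<or> l y \<noteq> 0")
    case True
    then show ?thesis using gen[OF y] form_on_line[OF G, of a y] by blast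
  next
    \<comment> \<open>Here \<open>l\<close> cannot be cancelled along \<open>y\<close>; but the low coefficients along \<open>y + u w\<close> are
      polynomials in \<open>u\<close> that vanish for all \<open>u \<noteq> 0\<close>.\<close>
    case False
    then have 0: "l y = 0" by simp
    obtain Q where Q: "\<forall>u s. G (\<lambda>i. a i + s * (y i + u * w i)) = poly (map_poly (\<lambda>q. poly q u) Q) s"
      using form_on_plane[OF G] by blast
    have "monom 1 m' dvd map_poly (\<lambda>q. poly q u) Q" if "u \<noteq> 0" for u
      by (rule gen[of "\<lambda>i. y i + u * w i"]) (use that W[OF y w(1)] lin 0 w(2) Q in auto)
    then have "\<forall>k<m'. coeff (map_poly (\<lambda>q. poly q u) Q) k = 0" if "u \<noteq> 0" for u
      using that monom_1_dvd_iff' by blast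
    then have "coeff Q k = 0" if "k < m'" for k
      using that by (intro poly_eqI_nonzero[OF inf]) (simp add: coeff_map_poly)
    then have "monom 1 m' dvd map_poly (\<lambda>q. poly q 0) Q"
      by (simp add: monom_1_dvd_iff' coeff_map_poly)
    moreover have "\<forall>s. G (\<lambda>i. a i + s * y i) = poly (map_poly (\<lambda>q. poly q 0) Q) s"
      using spec[OF Q, of 0] by simp
    ultimately show ?thesis by blast
  qed
  then show ?thesis
    unfolding vanishes_to_order_def m'_def by blast
qed


section \<open>The degree bound for forms over an infinite domain\<close>

text \<open>
  The value of \<open>\<alpha>\<close> for the \<open>m\<close>-th symbolic power when \<open>v = n + e\<close>. For \<open>n = 1\<close> it is only
  a lower bound, coming from the \<open>e\<close> points left when one of the \<open>e + 1\<close> points is a block.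
\<close>

definition degree_bound :: "nat \<Rightarrow> nat \<Rightarrow> nat \<Rightarrow> nat" where
  "degree_bound e n m =
     (if n = 1 then e * m
      else e * ((m + n - 1) div n) + m - (if m mod n = 1 then 1 else 0))"

section \<open>Arithmetic of the degree bound\<close>

lemma degree_bound_0: "0 < n \<Longrightarrow> degree_bound e n 0 = 0"
  by (simp add: degree_bound_def)

text \<open>The expression is the quotient of m = p n + q by n, rounded up. An exact multiple of n
  is covered by q = n.\<close>

lemma ceil_div_eq:
  fixes n m :: nat
  assumes "0 < n" "0 < q" "q \<le> n"
  shows "(p * n + q + n - 1) div n = p + 1"
proof -
  have "p * n + q + n - 1 = (q - 1) + (p + 1) * n"
    using assms by (simp add: algebra_simps)
  then show ?thesis using assms by (simp only: div_mult_self1) simp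
qed

lemma degree_bound_eq:
  assumes "2 \<le> n" "q < n"
  shows "degree_bound e n (p * n + q) =
     p * (n + e) + (if q = 0 then 0 else if q = 1 then e else e + q)"
proof (cases "q = 0")
  case True
  have "(p * n + n - 1) div n = p"
    using assms ceil_div_eq[of n n "p - 1"] by (cases p) (auto simp: algebra_simps)
  then show ?thesis using assms True by (simp add: degree_bound_def algebra_simps)
next
  case False
  then show ?thesis using assms ceil_div_eq[of n q p]
    by (auto simp: degree_bound_def algebra_simps)
qed

text \<open>Removing one copy of each of the e + n linear forms lowers the order at a point by n.
  For m >= n this is the periodicity of the bound, an equality; for m < n the truncated difference
  is 0 and the bound is at most e + m.\<close>

lemma degree_bound_step:
  assumes "2 \<le> n" "0 < m"
  shows "degree_bound e n m \<le> degree_bound e n (m - n) + (e + n)"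
proof (cases "m < n")
  case True
  then show ?thesis using assms degree_bound_eq[of n m e 0] degree_bound_0[of n e] by auto
next
  case False
  define p q where "p = m div n - 1" and "q = m mod n"
  have "0 < m div n" using False assms by (simp add: div_greater_zero_iff)
  then have "m div n = p + 1" by (simp add: p_def)
  then have m: "m = (p + 1) * n + q"
    using div_mult_mod_eq[of m n] by (simp add: q_def)
  then have mn: "m - n = p * n + q" by simp
  have q: "q < n" using assms by (simp add: q_def)
  have "degree_bound e n m = degree_bound e n (m - n) + (e + n)"
    unfolding mn unfolding m degree_bound_eq[OF assms(1) q] by (simp add: algebra_simps)
  then show ?thesis by simp
qed

text \<open>This compares the bound in dimension n with that on a hyperplane. For n > 2, dividing by
  n - 1 can only increase the rounded-up quotient, and a correction for remainder 1 that occurs only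
  modulo n - 1 is absorbed by that increase.\<close>

lemma degree_bound_mono:
  assumes "2 \<le> n" "2 \<le> e"
  shows "degree_bound e n m \<le> degree_bound e (n - 1) m"
proof -
  define p q where "p = m div n" and "q = m mod n"
  have m: "m = p * n + q" and q: "q < n"
    using assms by (auto simp: p_def q_def)
  have *: "degree_bound e n m = p * (n + e) + (if q = 0 then 0 else if q = 1 then e else e + q)"
    using degree_bound_eq[OF assms(1) q] m by simp
  show ?thesis
  proof (cases "n = 2")
    case True
    \<comment> \<open>On a line the bound is e m, and for m = 2 p the claim reads p (2 + e) <= 2 p
      e; here e >= 2 is decisive.\<close>
    obtain e' where e: "e = e' + 2" using assms(2) le_Suc_ex add.commute by metis
    have "q = 0 \<or> q = 1" using q True by auto
    then show ?thesis using * m True e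
      by (auto simp: degree_bound_def algebra_simps)
  next
    case False
    define a r where "a = m div (n - 1)" and "r = m mod (n - 1)"
    have r: "m = a * (n - 1) + r" "r < n - 1"
      unfolding a_def r_def using assms False by (simp_all only: div_mult_mod_eq) simp
    have n: "2 \<le> n - 1" using False assms by simp
    have b: "degree_bound e (n - 1) m =
        a * (n - 1 + e) + (if r = 0 then 0 else if r = 1 then e else e + r)"
      using degree_bound_eq[OF n r(2)] r(1) by simp
    have pa: "p \<le> a" unfolding p_def a_def
      using n by (intro div_le_mono2) auto
    show ?thesis
    proof (cases "p = a")
      case True
      \<comment> \<open>With equal quotients, replacing n by n - 1 adds p to the remainder.\<close>
      then have "a + q = r" using m r n by (cases n) (auto simp: algebra_simps)
      then show ?thesis unfolding * b using True n assms(2)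
        by (cases n) (auto simp: algebra_simps)
    next
      case False
      then obtain c where a: "a = p + 1 + c"
        using pa le_Suc_ex[of "p + 1" a] by auto
      have mm: "p * n + q = a * (n - 1) + r" using m r by simp
      have "degree_bound e n m \<le> p * n + q + e * (p + (if q = 0 then 0 else 1))"
        unfolding * by (simp add: algebra_simps)
      moreover have "degree_bound e (n - 1) m + (if r = 1 then 1 else 0) =
          a * (n - 1) + r + e * (a + (if r = 0 then 0 else 1))"
        unfolding b by (simp add: algebra_simps)
      \<comment> \<open>For r = 1 the rounded-up quotient by n - 1 is at least p + 2, so one further
        e pays for the correction.\<close>
      moreover have "e * (p + (if q = 0 then 0 else 1)) + (if r = 1 then 1 else 0)
          \<le> e * (a + (if r = 0 then 0 else 1))"
      proof -
        have "e * (p + (if q = 0 then 0 else 1)) \<le> e * (p + 1)"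
          by (intro mult_le_mono) auto
        moreover have "e * (p + 1) + (if r = 1 then 1 else 0) \<le> e * (p + 1 + (if r = 0 then 0 else 1))"
          using assms by simp
        moreover have "e * (p + 1 + (if r = 0 then 0 else 1)) \<le> e * (a + (if r = 0 then 0 else 1))"
          using a by (intro mult_le_mono) auto
        ultimately show ?thesis by linarith
      qed
      ultimately show ?thesis using mm by linarith
    qed
  qed
qed

text \<open>The scalars will be k[X], a domain but not a field. A form outside
  \<open>\<sigma>\<close> must therefore take a unit value at \<open>P \<sigma>\<close>, not just a
  nonzero one, so that vectors with \<open>L j w = 1\<close> exist.\<close>

locale linear_forms =
  fixes n v :: nat
    and L :: "nat \<Rightarrow> (nat \<Rightarrow> 'a::idom) \<Rightarrow> 'a"
    and P :: "nat set \<Rightarrow> nat \<Rightarrow> 'a"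
  assumes infinite_scalars: "infinite (UNIV :: 'a set)"
    and n_less_v: "n < v"
    and form_L: "j \<in> {1..v} \<Longrightarrow> form 1 (L j)"
    and L_line: "j \<in> {1..v} \<Longrightarrow> L j (\<lambda>i. x i + s * y i) = L j x + s * L j y"
    and P_support: "\<sigma> \<in> subsets_of_size n v \<Longrightarrow> n < i \<Longrightarrow> P \<sigma> i = 0"
    and L_P: "\<sigma> \<in> subsets_of_size n v \<Longrightarrow> j \<in> \<sigma> \<Longrightarrow> L j (P \<sigma>) = 0"
    and L_P_unit: "\<sigma> \<in> subsets_of_size n v \<Longrightarrow> j \<in> {1..v} - \<sigma> \<Longrightarrow> L j (P \<sigma>) dvd 1"
    and common_zero: "\<sigma> \<in> subsets_of_size n v \<Longrightarrow> (\<And>i. n < i \<Longrightarrow> x i = 0) \<Longrightarrow>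
      (\<And>j. j \<in> \<sigma> \<Longrightarrow> L j x = 0) \<Longrightarrow> \<exists>c. x = (\<lambda>i. c * P \<sigma> i)"
begin

text \<open>The linear space over the intersection of the hyperplanes with index in
  \<open>\<tau>\<close>. Staying in the ambient coordinates avoids a choice of coordinates on each
  intersection during the induction.\<close>

definition flat :: "nat set \<Rightarrow> (nat \<Rightarrow> 'a) set" where
  "flat \<tau> = {x. (\<forall>i>n. x i = 0) \<and> (\<forall>j\<in>\<tau>. L j x = 0)}"

section \<open>Division by linear forms on flats\<close>

lemma L_P_eq_0_iff:
  "\<sigma> \<in> subsets_of_size n v \<Longrightarrow> j \<in> {1..v} \<Longrightarrow> L j (P \<sigma>) = 0 \<longleftrightarrow> j \<in> \<sigma>"
  using L_P L_P_unit by fastforce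

lemma flat_line:
  "\<tau> \<subseteq> {1..v} \<Longrightarrow> x \<in> flat \<tau> \<Longrightarrow> y \<in> flat \<tau> \<Longrightarrow> (\<lambda>i. x i + s * y i) \<in> flat \<tau>"
  by (auto simp: flat_def L_line subset_eq)

lemma P_in_flat: "\<sigma> \<in> subsets_of_size n v \<Longrightarrow> \<tau> \<subseteq> \<sigma> \<Longrightarrow> P \<sigma> \<in> flat \<tau>"
  by (auto simp: flat_def P_support L_P)

lemma L_smult: "j \<in> {1..v} \<Longrightarrow> L j (\<lambda>i. c * x i) = c * L j x"
  using form_homogeneous[OF form_L] by simp

lemma zero_in_flat: "\<tau> \<subseteq> {1..v} \<Longrightarrow> (\<lambda>i. 0) \<in> flat \<tau>"
  using L_smult[where c = 0 and x = "\<lambda>i. 0"] by (auto simp: flat_def)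

text \<open>Since n < v, the set \<open>\<tau>\<close> extends to an n-set \<open>\<sigma>\<close>
  that avoids \<open>j\<close>; dividing \<open>P \<sigma>\<close> by the unit
  \<open>L j (P \<sigma>)\<close> gives w.\<close>

lemma exists_transversal:
  assumes "\<tau> \<subseteq> {1..v}" "card \<tau> \<le> n" "j \<in> {1..v} - \<tau>"
  obtains w where "w \<in> flat \<tau>" "L j w = 1"
proof -
  have "\<exists>\<sigma>. \<tau> \<subseteq> \<sigma> \<and> \<sigma> \<subseteq> {1..v} - {j} \<and> card \<sigma> = n"
    using assms n_less_v by (intro exists_subset_between) auto
  then obtain \<sigma> where \<sigma>: "\<tau> \<subseteq> \<sigma>" "\<sigma> \<in> subsets_of_size n v" "j \<notin> \<sigma>"
    by (auto simp: subsets_of_size_def)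
  then obtain c where "1 = L j (P \<sigma>) * c"
    using L_P_unit assms(3) by blast
  then have "L j (\<lambda>i. 0 + c * P \<sigma> i) = 1"
    using assms(3) by (simp add: L_smult mult.commute)
  moreover have "(\<lambda>i. 0 + c * P \<sigma> i) \<in> flat \<tau>"
    using assms(1) \<sigma> flat_line zero_in_flat P_in_flat by blast
  ultimately show ?thesis using that by blast
qed

text \<open>A vector of the flat is projected along w into the kernel of \<open>L j\<close>, where
  \<open>F\<close> vanishes, and \<open>form_decompose\<close> leaves only the multiple of
  \<open>L j\<close>. The degree is positive because a nonzero constant does not vanish at the
  origin.\<close>

lemma divide_by_linear_form:
  assumes "form d F" and \<tau>: "\<tau> \<subseteq> {1..v}" "card \<tau> \<le> n" "j \<in> {1..v} - \<tau>"
    and zero: "\<And>x. x \<in> flat (insert j \<tau>) \<Longrightarrow> F x = 0"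
    and nonzero: "x \<in> flat \<tau>" "F x \<noteq> 0"
  obtains e G where "d = Suc e" "form e G" "\<And>x. x \<in> flat \<tau> \<Longrightarrow> F x = L j x * G x"
proof -
  have "d \<noteq> 0"
  proof
    assume "d = 0"
    then have "F x = F (\<lambda>i. 0)"
      using form_0_const assms(1) by blast
    moreover have "insert j \<tau> \<subseteq> {1..v}" using \<tau> by auto
    ultimately show False
      using nonzero(2) zero zero_in_flat by auto
  qed
  then obtain e where e: "d = Suc e" by (cases d) auto
  obtain w where w: "w \<in> flat \<tau>" "L j w = 1"
    using exists_transversal[OF \<tau>] .
  have L: "form 1 (L j)" using \<tau>(3) form_L by blast
  obtain G where G: "form e G" "\<forall>x. F x = F (\<lambda>i. x i - L j x * w i) + L j x * G x"
    using form_decompose[OF assms(1) L refl e, of w] by blast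
  have "F x = L j x * G x" if "x \<in> flat \<tau>" for x
  proof -
    let ?y = "\<lambda>i. x i + (- L j x) * w i"
    have "?y \<in> flat (insert j \<tau>)"
      using flat_line[OF \<tau>(1) that w(1), of "- L j x"] L_line[of j x "- L j x" w] w(2) \<tau>(3)
      by (simp add: flat_def)
    then have "F ?y = 0" by (rule zero)
    then show ?thesis using spec[OF G(2), of x] by simp
  qed
  with e G(1) that show ?thesis by blast
qed

text \<open>This lets the division continue with the next form. Where \<open>L j\<close> is nonzero
  it can be cancelled. From a common zero of \<open>L j\<close> and \<open>L k\<close> one moves
  along a line inside the kernel of \<open>L k\<close> on which \<open>L j\<close> takes the value
  s; the restriction of \<open>G\<close> vanishes for nonzero s, hence for s = 0.\<close>

lemma quotient_vanishes_on_flat: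
  assumes "form e G" and \<tau>: "\<tau> \<subseteq> {1..v}" "card \<tau> < n" and j: "j \<in> {1..v} - \<tau>" "k \<in> {1..v} - \<tau>" "j \<noteq> k"
    and F: "\<And>x. x \<in> flat \<tau> \<Longrightarrow> F x = L j x * G x"
    and zero: "\<And>x. x \<in> flat (insert k \<tau>) \<Longrightarrow> F x = 0"
    and x: "x \<in> flat (insert k \<tau>)"
  shows "G x = 0"
proof (cases "L j x = 0")
  case False
  have "x \<in> flat \<tau>" using x by (auto simp: flat_def)
  then show ?thesis using F zero[OF x] False by auto
next
  case True
  have k: "insert k \<tau> \<subseteq> {1..v}" "card (insert k \<tau>) \<le> n" "j \<in> {1..v} - insert k \<tau>"
    using \<tau> j finite_subset[of \<tau> "{1..v}"] by (auto simp: card_insert_if)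
  obtain w where w: "w \<in> flat (insert k \<tau>)" "L j w = 1"
    using exists_transversal[OF k] .
  obtain p where p: "\<forall>s. G (\<lambda>i. x i + s * w i) = poly p s"
    using form_on_line[OF assms(1)] by blast
  have "poly p s = poly 0 s" if "s \<noteq> 0" for s
  proof -
    have y: "(\<lambda>i. x i + s * w i) \<in> flat (insert k \<tau>)"
      using flat_line[OF k(1) x w(1)] .
    then have "(\<lambda>i. x i + s * w i) \<in> flat \<tau>" by (auto simp: flat_def)
    from F[OF this] zero[OF y] have "s * G (\<lambda>i. x i + s * w i) = 0"
      using True w(2) L_line[of j x s w] j(1) by simp
    with that p show ?thesis by simp
  qed
  then have "p = 0"
    by (rule poly_eqI_nonzero[OF infinite_scalars])
  with spec[OF p, of 0] show ?thesis by simp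
qed

text \<open>The order is a function of \<open>\<sigma>\<close> because dividing by
  \<open>L j\<close> lowers it only at the points with j in \<open>\<sigma>\<close>; a constant
  order would not survive the induction over \<open>J\<close>.\<close>

lemma divide_by_linear_forms:
  assumes \<tau>: "\<tau> \<subseteq> {1..v}" "card \<tau> < n" and C: "C \<subseteq> subsets_of_size n v"
    and "finite J" "J \<subseteq> {1..v} - \<tau>"
    and "form d F" "\<exists>x\<in>flat \<tau>. F x \<noteq> 0"
    and "\<And>j x. j \<in> J \<Longrightarrow> x \<in> flat (insert j \<tau>) \<Longrightarrow> F x = 0"
    and "\<And>\<sigma>. \<sigma> \<in> C \<Longrightarrow> \<tau> \<subseteq> \<sigma> \<Longrightarrow> vanishes_to_order (m \<sigma>) F (flat \<tau>) (P \<sigma>)"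
  shows "card J \<le> d \<and> (\<exists>G. form (d - card J) G \<and> (\<exists>x\<in>flat \<tau>. G x \<noteq> 0) \<and>
    (\<forall>\<sigma>\<in>C. \<tau> \<subseteq> \<sigma> \<longrightarrow> vanishes_to_order (m \<sigma> - card (J \<inter> \<sigma>)) G (flat \<tau>) (P \<sigma>)))"
  using assms(4-)
proof (induction J arbitrary: d F m rule: finite_induct)
  case empty
  then show ?case by auto
next
  case (insert j J)
  obtain x where x: "x \<in> flat \<tau>" "F x \<noteq> 0" using insert.prems(3) by blast
  have j: "j \<in> {1..v} - \<tau>" using insert.prems(1) by simp
  obtain e G where G: "d = Suc e" "form e G" "\<And>x. x \<in> flat \<tau> \<Longrightarrow> F x = L j x * G x"
    using divide_by_linear_form[OF insert.prems(2) \<tau>(1) less_imp_le[OF \<tau>(2)] j _ x] insert.prems(4)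
    by blast
  have nz: "\<exists>x\<in>flat \<tau>. G x \<noteq> 0" using x G(3) by auto
  have zero: "G x = 0" if "k \<in> J" "x \<in> flat (insert k \<tau>)" for k x
    using quotient_vanishes_on_flat[OF G(2) \<tau> j _ _ G(3) _ that(2)] insert.prems(1,4) that insert.hyps
    by blast
  obtain w where w: "w \<in> flat \<tau>" "L j w = 1"
    using exists_transversal[OF \<tau>(1) less_imp_le[OF \<tau>(2)] j] .
  define m' where "m' = (\<lambda>\<sigma>. if j \<in> \<sigma> then m \<sigma> - 1 else m \<sigma>)"
  have van: "vanishes_to_order (m' \<sigma>) G (flat \<tau>) (P \<sigma>)"
    if "\<sigma> \<in> C" "\<tau> \<subseteq> \<sigma>" for \<sigma>
  proof -
    have \<sigma>: "\<sigma> \<in> subsets_of_size n v" using C that by blast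
    have jv: "j \<in> {1..v}" using j by simp
    have "vanishes_to_order (if L j (P \<sigma>) = 0 then m \<sigma> - 1 else m \<sigma>) G (flat \<tau>) (P \<sigma>)"
    proof (rule vanishes_to_order_quotient[OF infinite_scalars G(2) insert.prems(5)[OF that] G(3)])
      show "L j w \<noteq> 0" using w by simp
    qed (use L_line[OF jv] flat_line[OF \<tau>(1)] P_in_flat[OF \<sigma> that(2)] w in auto)
    then show ?thesis using L_P_eq_0_iff[OF \<sigma> jv] by (simp add: m'_def)
  qed
  have "J \<subseteq> {1..v} - \<tau>" using insert.prems(1) by simp
  from insert.IH[where m = m', OF this G(2) nz zero van]
  have IH: "card J \<le> e \<and> (\<exists>G'. form (e - card J) G' \<and> (\<exists>x\<in>flat \<tau>. G' x \<noteq> 0) \<and>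
    (\<forall>\<sigma>\<in>C. \<tau> \<subseteq> \<sigma> \<longrightarrow> vanishes_to_order (m' \<sigma> - card (J \<inter> \<sigma>)) G' (flat \<tau>) (P \<sigma>)))" .
  have "m' \<sigma> - card (J \<inter> \<sigma>) = m \<sigma> - card (insert j J \<inter> \<sigma>)" for \<sigma>
    using insert.hyps by (simp add: m'_def)
  with IH show ?case using G(1) insert.hyps by simp
qed

lemma form_vanishes_at_point:
  assumes "form d F" "0 < m" "\<sigma> \<in> subsets_of_size n v"
    and van: "vanishes_to_order m F (flat \<tau>) (P \<sigma>)" and "\<tau> \<subseteq> {1..v}"
    and x: "x \<in> flat \<sigma>"
  shows "F x = 0"
proof -
  \<comment> \<open>In direction 0 the restriction is constant with the value of \<open>F\<close> at
    \<open>P \<sigma>\<close>, and a positive order makes it zero; multiples of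
    \<open>P \<sigma>\<close> follow by homogeneity.\<close>
  obtain p where p: "\<forall>s. F (\<lambda>i. P \<sigma> i + s * 0) = poly p s" "monom 1 m dvd p"
    using van zero_in_flat[OF assms(5)] by (auto simp: vanishes_to_order_def)
  have "coeff p 0 = 0" using p(2) assms(2) by (simp add: monom_1_dvd_iff')
  then have "F (P \<sigma>) = 0" using spec[OF p(1), of 0] by (simp add: poly_0_coeff_0)
  moreover obtain c where "x = (\<lambda>i. c * P \<sigma> i)"
    using common_zero[OF assms(3), of x] x by (auto simp: flat_def)
  ultimately show ?thesis using form_homogeneous[OF assms(1)] by simp
qed

text \<open>The outer induction is on the projective dimension r of the flat of
  \<open>\<tau>\<close>; the points of \<open>C\<close> on it are those with \<open>\<tau>\<close>
  contained in \<open>\<sigma>\<close>. Working with \<open>\<tau>\<close> instead of a derived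
  system keeps n, v and the packing hypothesis fixed; packing is applied only at r = 1.\<close>

lemma degree_lower_bound:
  assumes e: "v = n + e" "2 \<le> e"
    and packing: "\<And>\<beta> \<beta>' \<tau>. \<beta> \<in> B \<Longrightarrow> \<beta>' \<in> B \<Longrightarrow> card \<tau> = n - 1 \<Longrightarrow> \<tau> \<subseteq> \<beta> \<Longrightarrow> \<tau> \<subseteq> \<beta>' \<Longrightarrow> \<beta> = \<beta>'"
    and C: "C = subsets_of_size n v - B"
  shows "1 \<le> r \<Longrightarrow> \<tau> \<subseteq> {1..v} \<Longrightarrow> card \<tau> + r = n \<Longrightarrow> form d F \<Longrightarrow> \<exists>x\<in>flat \<tau>. F x \<noteq> 0 \<Longrightarrow>
    \<forall>\<sigma>\<in>C. \<tau> \<subseteq> \<sigma> \<longrightarrow> vanishes_to_order m F (flat \<tau>) (P \<sigma>) \<Longrightarrow> degree_bound e r m \<le> d"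
proof (induction r arbitrary: \<tau> m d F)
  case 0
  then show ?case by simp
next
  case (Suc r)
  have \<tau>: "\<tau> \<subseteq> {1..v}" "card \<tau> < n" "finite \<tau>"
    using Suc.prems finite_subset[of \<tau> "{1..v}"] by auto
  have CS: "C \<subseteq> subsets_of_size n v" using C by simp
  show ?case
  proof (cases "r = 0")
    case True
    then have card: "card \<tau> = n - 1" "0 < n" using Suc.prems by auto
    \<comment> \<open>The flat is a projective line, and its points correspond to the e + 1 indices
      outside \<open>\<tau>\<close>; \<open>J\<close> selects those that belong to
      \<open>C\<close>.\<close>
    define J where "J = {j \<in> {1..v} - \<tau>. insert j \<tau> \<in> C}"
    have ins: "insert j \<tau> \<in> subsets_of_size n v" if "j \<in> {1..v} - \<tau>" for j
      using that \<tau> card by (auto simp: subsets_of_size_def card_insert_if)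
    have "card ({1..v} - \<tau> - J) \<le> 1"
    proof -
      have "j = k" if "j \<in> {1..v} - \<tau> - J" "k \<in> {1..v} - \<tau> - J" for j k
      proof -
        \<comment> \<open>Two points left out of \<open>C\<close> would be blocks through the same
          (n - 1)-set \<open>\<tau>\<close>.\<close>
        have "insert j \<tau> = insert k \<tau>"
          using that ins by (intro packing[OF _ _ card(1)]) (auto simp: C J_def)
        then show ?thesis using that by blast
      qed
      then show ?thesis by (simp add: card_le_Suc0_iff_eq)
    qed
    moreover have "card ({1..v} - \<tau>) = e + 1"
      using \<tau> card e by (simp add: card_Diff_subset)
    moreover have "card ({1..v} - \<tau> - J) = card ({1..v} - \<tau>) - card J"
      by (rule card_Diff_subset) (auto simp: J_def)
    ultimately have J: "e \<le> card J" by linarith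
    have fin: "finite J" "J \<subseteq> {1..v} - \<tau>" by (auto simp: J_def)
    have "e * m \<le> d"
      using Suc.prems(4-6)
    proof (induction m arbitrary: d F)
      case 0
      then show ?case by simp
    next
      case (Suc m)
      have "F x = 0" if "j \<in> J" "x \<in> flat (insert j \<tau>)" for j x
        using form_vanishes_at_point[OF Suc.prems(1), of "Suc m" "insert j \<tau>" \<tau> x] that Suc.prems(3) \<tau> CS
        by (auto simp: J_def)
      then obtain G where G: "card J \<le> d" "form (d - card J) G" "\<exists>x\<in>flat \<tau>. G x \<noteq> 0"
        "\<forall>\<sigma>\<in>C. \<tau> \<subseteq> \<sigma> \<longrightarrow> vanishes_to_order (Suc m - card (J \<inter> \<sigma>)) G (flat \<tau>) (P \<sigma>)"
        using divide_by_linear_forms[where m = "\<lambda>_. Suc m", OF \<tau>(1,2) CS fin Suc.prems(1,2)] Suc.prems(3)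
        by blast
      \<comment> \<open>A point of \<open>C\<close> on the line is a zero of exactly one form of
        \<open>J\<close>, so dividing by all of \<open>J\<close> costs one order and at least e
        degrees.\<close>
      have "card (J \<inter> \<sigma>) = 1" if \<sigma>: "\<sigma> \<in> C" "\<tau> \<subseteq> \<sigma>" for \<sigma>
      proof -
        have "\<sigma> \<in> subsets_of_size n v" using \<sigma> CS by blast
        then have \<sigma>': "\<sigma> \<subseteq> {1..v}" "card \<sigma> = n" by (auto simp: subsets_of_size_def)
        then have "card (\<sigma> - \<tau>) = 1"
          using card \<tau>(3) \<sigma>(2) by (simp add: card_Diff_subset)
        then obtain j where j: "\<sigma> - \<tau> = {j}" by (auto simp: card_1_singleton_iff)
        then have "\<sigma> = insert j \<tau>" using \<sigma>(2) by auto
        then have "J \<inter> \<sigma> = {j}"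
          using j \<sigma> \<sigma>' by (auto simp: J_def)
        then show ?thesis by simp
      qed
      with G(4) have "\<forall>\<sigma>\<in>C. \<tau> \<subseteq> \<sigma> \<longrightarrow> vanishes_to_order m G (flat \<tau>) (P \<sigma>)"
        by simp
      from Suc.IH[OF G(2,3) this] G(1) J show ?case by simp
    qed
    with True show ?thesis by (simp add: degree_bound_def)
  next
    case False
    let ?J = "{1..v} - \<tau>"
    have cardJ: "card ?J = e + Suc r"
      using \<tau> Suc.prems(3) e by (simp add: card_Diff_subset)
    \<comment> \<open>Of the n forms that vanish at \<open>P \<sigma>\<close>, those in
      \<open>\<tau>\<close> are not divided out.\<close>
    have J\<sigma>: "card (?J \<inter> \<sigma>) = Suc r" if "\<sigma> \<in> C" "\<tau> \<subseteq> \<sigma>" for \<sigma>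
    proof -
      have \<sigma>: "\<sigma> \<subseteq> {1..v}" "card \<sigma> = n"
        using that CS by (auto simp: subsets_of_size_def)
      then have "?J \<inter> \<sigma> = \<sigma> - \<tau>" by auto
      then show ?thesis using \<sigma> \<tau> that(2) Suc.prems(3) by (simp add: card_Diff_subset)
    qed
    show ?thesis
      using Suc.prems(4-6)
    proof (induction m arbitrary: d F rule: less_induct)
      case (less m)
      show ?case
      proof (cases "m = 0 \<or> degree_bound e (Suc r) m \<le> d")
        case True
        then show ?thesis by (auto simp: degree_bound_0)
      next
        case c: False
        have zero: "F x = 0" if j: "j \<in> ?J" and x: "x \<in> flat (insert j \<tau>)" for j x
        proof (rule ccontr)
          assume "F x \<noteq> 0"
          then have nz: "\<exists>x\<in>flat (insert j \<tau>). F x \<noteq> 0" using x by blast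
          have sub: "flat (insert j \<tau>) \<subseteq> flat \<tau>" by (auto simp: flat_def)
          have van: "\<forall>\<sigma>\<in>C. insert j \<tau> \<subseteq> \<sigma> \<longrightarrow> vanishes_to_order m F (flat (insert j \<tau>)) (P \<sigma>)"
            using less.prems(3) vanishes_to_order_subset[OF _ sub] by blast
          have ins: "card (insert j \<tau>) + r = n" "insert j \<tau> \<subseteq> {1..v}"
            using j \<tau> Suc.prems(3) by auto
          \<comment> \<open>A nonzero restriction to the smaller flat would have at least the degree
            required there, which is no less than the present bound.\<close>
          have "degree_bound e r m \<le> d"
            using Suc.IH[OF _ ins(2,1) less.prems(1) nz van] False by simp
          moreover have "degree_bound e (Suc r) m \<le> degree_bound e r m"
            using degree_bound_mono[of "Suc r" e m] False e(2) by simp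
          ultimately show False using c by simp
        qed
        have "card ?J \<le> d \<and> (\<exists>G. form (d - card ?J) G \<and> (\<exists>x\<in>flat \<tau>. G x \<noteq> 0) \<and>
          (\<forall>\<sigma>\<in>C. \<tau> \<subseteq> \<sigma> \<longrightarrow> vanishes_to_order (m - card (?J \<inter> \<sigma>)) G (flat \<tau>) (P \<sigma>)))"
          by (rule divide_by_linear_forms[where m = "\<lambda>_. m", OF \<tau>(1,2) CS
                finite_Diff[OF finite_atLeastAtMost] order_refl less.prems(1,2) zero])
            (use less.prems(3) in auto)
        then obtain G where G: "card ?J \<le> d" "form (d - card ?J) G" "\<exists>x\<in>flat \<tau>. G x \<noteq> 0"
          "\<forall>\<sigma>\<in>C. \<tau> \<subseteq> \<sigma> \<longrightarrow> vanishes_to_order (m - card (?J \<inter> \<sigma>)) G (flat \<tau>) (P \<sigma>)"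
          by blast
        have "\<forall>\<sigma>\<in>C. \<tau> \<subseteq> \<sigma> \<longrightarrow> vanishes_to_order (m - Suc r) G (flat \<tau>) (P \<sigma>)"
          using G(4) J\<sigma> by simp
        \<comment> \<open>Here m > 0, so the order of the quotient is below m and the inner
          induction applies; the e + r + 1 degrees divided out then restore the bound for m.\<close>
        then have "degree_bound e (Suc r) (m - Suc r) \<le> d - card ?J"
          using c G(2,3) by (intro less.IH) auto
        moreover have "degree_bound e (Suc r) m \<le> degree_bound e (Suc r) (m - Suc r) + (e + Suc r)"
          using c False by (intro degree_bound_step) auto
        ultimately show ?thesis using G(1) cardJ by linarith
      qed
    qed
  qed
qed

end


section \<open>Evaluation of polynomials\<close>

definition monomial_value :: "(nat \<Rightarrow> 'r::comm_ring_1) \<Rightarrow> (nat \<Rightarrow>\<^sub>0 nat) \<Rightarrow> 'r" where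
  "monomial_value x a = (\<Prod>i \<in> Poly_Mapping.keys a. x i ^ Poly_Mapping.lookup a i)"

lemma monomial_value_superset:
  "finite A \<Longrightarrow> Poly_Mapping.keys a \<subseteq> A \<Longrightarrow>
    monomial_value x a = (\<Prod>i\<in>A. x i ^ Poly_Mapping.lookup a i)"
  unfolding monomial_value_def
  by (rule prod.mono_neutral_left) (auto simp: in_keys_iff)

lemma monomial_value_add: "monomial_value x (a + b) = monomial_value x a * monomial_value x b"
proof -
  let ?A = "Poly_Mapping.keys a \<union> Poly_Mapping.keys b"
  have "Poly_Mapping.keys (a + b) \<subseteq> ?A" by (rule Poly_Mapping.keys_add)
  then show ?thesis
    by (simp add: monomial_value_superset[of ?A] lookup_add power_add prod.distrib)
qed

lemma monomial_degree_superset: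
  "finite A \<Longrightarrow> Poly_Mapping.keys a \<subseteq> A \<Longrightarrow>
    monomial_degree a = (\<Sum>i\<in>A. Poly_Mapping.lookup a i)"
  unfolding monomial_degree_def
  by (rule sum.mono_neutral_left) (auto simp: in_keys_iff)

lemma monomial_degree_add: "monomial_degree (a + b) = monomial_degree a + monomial_degree b"
proof -
  let ?A = "Poly_Mapping.keys a \<union> Poly_Mapping.keys b"
  have "Poly_Mapping.keys (a + b) \<subseteq> ?A" by (rule Poly_Mapping.keys_add)
  then show ?thesis
    by (simp add: monomial_degree_superset[of ?A] lookup_add sum.distrib)
qed

lemma lookup_le_monomial_degree: "Poly_Mapping.lookup a i \<le> monomial_degree a"
  by (cases "i \<in> Poly_Mapping.keys a")
    (auto simp: monomial_degree_def in_keys_iff intro: member_le_sum)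

lemma monomial_degree_1:
  assumes "monomial_degree a = 1"
  obtains i where "a = Poly_Mapping.single i 1"
proof -
  have "Poly_Mapping.keys a \<noteq> {}" using assms by (auto simp: monomial_degree_def)
  then obtain i where i: "i \<in> Poly_Mapping.keys a" by blast
  have eq: "Poly_Mapping.lookup a i + (\<Sum>k\<in>Poly_Mapping.keys a - {i}. Poly_Mapping.lookup a k) = 1"
    using assms sum.remove[OF _ i, of "Poly_Mapping.lookup a"] by (simp add: monomial_degree_def)
  have "Poly_Mapping.lookup a i \<noteq> 0" using i by (simp add: in_keys_iff)
  with eq have 1: "Poly_Mapping.lookup a i = 1"
    and "(\<Sum>k\<in>Poly_Mapping.keys a - {i}. Poly_Mapping.lookup a k) = 0" by linarith+
  then have "\<forall>k\<in>Poly_Mapping.keys a - {i}. Poly_Mapping.lookup a k = 0" by simp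
  then have "a = Poly_Mapping.single i 1"
    using 1 by (intro poly_mapping_eqI) (auto simp: lookup_single when_def in_keys_iff)
  then show ?thesis using that by blast
qed

lemma homogeneous_mult:
  "homogeneous_of_degree d p \<Longrightarrow> homogeneous_of_degree e q \<Longrightarrow> homogeneous_of_degree (d + e) (p * q)"
  unfolding homogeneous_of_degree_def
  using Poly_Mapping.keys_mult[of p q] by (fastforce simp: monomial_degree_add)

lemma sum_of_monomials: "(\<Sum>a\<in>Poly_Mapping.keys p. Poly_Mapping.single a (Poly_Mapping.lookup p a)) = p"
  by (rule poly_mapping_eqI) (simp add: lookup_sum lookup_single when_def in_keys_iff)

text \<open>The coefficient map \<open>h\<close> lets one polynomial be evaluated in k, in k[X] and
  in k[X][s]; the last gives restrictions to lines.\<close>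

definition eval_via :: "('k::field \<Rightarrow> 'r::comm_ring_1) \<Rightarrow> 'k mpoly \<Rightarrow> (nat \<Rightarrow> 'r) \<Rightarrow> 'r" where
  "eval_via h p x =
     (\<Sum>a \<in> Poly_Mapping.keys p. h (Poly_Mapping.lookup p a) * monomial_value x a)"

lemma poly_eval_eq: "poly_eval p x = eval_via (\<lambda>c. c) p x"
  by (simp add: poly_eval_def eval_via_def monomial_value_def)

locale coefficient_hom =
  fixes h :: "'k::field \<Rightarrow> 'r::comm_ring_1"
  assumes h_add: "h (a + b) = h a + h b"
    and h_mult: "h (a * b) = h a * h b"
    and h_0: "h 0 = 0"
    and h_1: "h 1 = 1"
begin

lemma eval_via_superset:
  "finite A \<Longrightarrow> Poly_Mapping.keys p \<subseteq> A \<Longrightarrow>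
    eval_via h p x = (\<Sum>a\<in>A. h (Poly_Mapping.lookup p a) * monomial_value x a)"
  unfolding eval_via_def
  by (rule sum.mono_neutral_left) (auto simp: in_keys_iff h_0)

lemma eval_via_add: "eval_via h (p + q) x = eval_via h p x + eval_via h q x"
proof -
  let ?A = "Poly_Mapping.keys p \<union> Poly_Mapping.keys q"
  have "Poly_Mapping.keys (p + q) \<subseteq> ?A" by (rule Poly_Mapping.keys_add)
  then show ?thesis
    by (simp add: eval_via_superset[of ?A] lookup_add h_add distrib_right sum.distrib)
qed

lemma eval_via_0: "eval_via h 0 x = 0"
  by (simp add: eval_via_def)

lemma eval_via_sum: "eval_via h (\<Sum>i\<in>I. f i) x = (\<Sum>i\<in>I. eval_via h (f i) x)"
  by (induction I rule: infinite_finite_induct) (auto simp: eval_via_0 eval_via_add)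

lemma eval_via_single: "eval_via h (Poly_Mapping.single a c) x = h c * monomial_value x a"
  by (subst eval_via_superset[of "{a}"]) auto

lemma eval_via_mult: "eval_via h (p * q) x = eval_via h p x * eval_via h q x"
proof -
  let ?s = "\<lambda>p a. Poly_Mapping.single a (Poly_Mapping.lookup p a)"
  have "p * q = (\<Sum>a\<in>Poly_Mapping.keys p. ?s p a) * (\<Sum>b\<in>Poly_Mapping.keys q. ?s q b)"
    by (simp only: sum_of_monomials)
  also have "\<dots> = (\<Sum>a\<in>Poly_Mapping.keys p. \<Sum>b\<in>Poly_Mapping.keys q.
      Poly_Mapping.single (a + b) (Poly_Mapping.lookup p a * Poly_Mapping.lookup q b))"
    by (simp only: sum_product mult_single)
  finally show ?thesis
    by (simp add: eval_via_sum eval_via_single monomial_value_add h_mult)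
      (simp add: eval_via_def sum_product mult_ac)
qed

lemma eval_via_linear_form:
  assumes "linear_form n l"
  shows "eval_via h l x = (\<Sum>i\<le>n. h (Poly_Mapping.lookup l (Poly_Mapping.single i 1)) * x i)"
proof -
  let ?A = "(\<lambda>i. Poly_Mapping.single i (1::nat)) ` {..n}"
  have "Poly_Mapping.keys l \<subseteq> ?A"
  proof
    fix a assume a: "a \<in> Poly_Mapping.keys l"
    then have "monomial_degree a = 1"
      using assms by (auto simp: linear_form_def homogeneous_of_degree_def)
    then obtain i where i: "a = Poly_Mapping.single i 1" by (rule monomial_degree_1)
    moreover have "Poly_Mapping.keys a \<subseteq> {0..n}"
      using assms a by (auto simp: linear_form_def poly_ring_def)
    ultimately show "a \<in> ?A" by auto
  qed
  moreover have inj: "inj_on (\<lambda>i. Poly_Mapping.single i (1::nat)) {..n}"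
    by (rule inj_onI) (drule arg_cong[of _ _ Poly_Mapping.keys], simp)
  ultimately have "eval_via h l x = (\<Sum>a\<in>?A. h (Poly_Mapping.lookup l a) * monomial_value x a)"
    by (intro eval_via_superset) auto
  also have "\<dots> = (\<Sum>i\<le>n. h (Poly_Mapping.lookup l (Poly_Mapping.single i 1)) *
      monomial_value x (Poly_Mapping.single i 1))"
    by (subst sum.reindex[OF inj]) simp
  finally show ?thesis
    by (simp add: monomial_value_def)
qed

end

lemma form_power: "form e F \<Longrightarrow> form (k * e) (\<lambda>x. F x ^ k)"
proof (induction k)
  case 0
  show ?case using form.const[of 1] by simp
next
  case (Suc k)
  then show ?case using form_mult[of e F "k * e"] by simp
qed

lemma form_prod:
  "finite A \<Longrightarrow> (\<And>i. i \<in> A \<Longrightarrow> form (d i) (F i)) \<Longrightarrow> form (\<Sum>i\<in>A. d i) (\<lambda>x. \<Prod>i\<in>A. F i x)"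
proof (induction A rule: finite_induct)
  case empty
  show ?case using form.const[of 1] by simp
next
  case (insert i A)
  then show ?case using form_mult[of "d i" "F i"] by simp
qed

lemma form_monomial_value: "form (monomial_degree a) (\<lambda>x. monomial_value x a)"
  unfolding monomial_degree_def monomial_value_def
proof (rule form_prod)
  fix i
  show "form (Poly_Mapping.lookup a i) (\<lambda>x. x i ^ Poly_Mapping.lookup a i :: 'a)"
    using form_power[OF form_coord[of i], of "Poly_Mapping.lookup a i"] by simp
qed simp

lemma form_eval_via:
  fixes h :: "'k::field \<Rightarrow> 'r::idom"
  assumes "homogeneous_of_degree d p"
  shows "form d (eval_via h p)"
proof -
  have "form d (\<lambda>x. h (Poly_Mapping.lookup p a) * monomial_value x a)"
    if "a \<in> Poly_Mapping.keys p" for a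
    using form_smult[OF form_monomial_value[of a]] that assms
    by (auto simp: homogeneous_of_degree_def)
  then have "form d (\<lambda>x. eval_via h p x)"
    unfolding eval_via_def by (rule form_sum)
  then show ?thesis .
qed

text \<open>Reduction modulo N recovers the lowest digit, and induction the others. It keeps the
  exponents of the Kronecker substitution apart.\<close>

lemma digits_unique:
  fixes f g :: "nat \<Rightarrow> nat"
  assumes "\<And>i. f i < N" "\<And>i. g i < N" "(\<Sum>i\<le>n. f i * N ^ i) = (\<Sum>i\<le>n. g i * N ^ i)" "i \<le> n"
  shows "f i = g i"
  using assms
proof (induction n arbitrary: f g i)
  case 0
  then show ?case by simp
next
  case (Suc n)
  have split: "(\<Sum>i\<le>Suc n. u i * N ^ i) = u 0 + N * (\<Sum>i\<le>n. u (Suc i) * N ^ i)" for u :: "nat \<Rightarrow> nat"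
    by (subst sum.atMost_Suc_shift) (simp add: sum_distrib_left mult_ac)
  have eq: "f 0 + N * (\<Sum>i\<le>n. f (Suc i) * N ^ i) = g 0 + N * (\<Sum>i\<le>n. g (Suc i) * N ^ i)"
    using Suc.prems(3) unfolding split .
  then have 0: "f 0 = g 0"
    using Suc.prems(1,2) by (metis mod_less mod_mult_self2)
  have "0 < N" using Suc.prems(1)[of 0] by simp
  then have "(\<Sum>i\<le>n. f (Suc i) * N ^ i) = (\<Sum>i\<le>n. g (Suc i) * N ^ i)"
    using eq 0 by simp
  then have "\<And>i. i \<le> n \<Longrightarrow> f (Suc i) = g (Suc i)"
    using Suc.IH[of "\<lambda>i. f (Suc i)" "\<lambda>i. g (Suc i)"] Suc.prems(1,2) by blast
  with 0 show ?case using Suc.prems(4) by (cases i) auto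
qed

lemma monomial_value_monom:
  "monomial_value (\<lambda>i. monom 1 (e i)) a =
     monom (1::'k::field) (\<Sum>i\<in>Poly_Mapping.keys a. Poly_Mapping.lookup a i * e i)"
proof -
  have "(\<Prod>i\<in>A. monom (1::'k) (e i) ^ Poly_Mapping.lookup a i) =
      monom 1 (\<Sum>i\<in>A. Poly_Mapping.lookup a i * e i)" if "finite A" for A
    using that by (induction A rule: finite_induct) (auto simp: monom_power mult_monom mult_ac)
  then show ?thesis by (simp add: monomial_value_def)
qed

text \<open>Kronecker substitution: \<open>x\<^sub>i = X ^ N ^ i\<close> with \<open>N\<close> exceeding all exponents.\<close>

lemma exists_nonzero_value:
  fixes p :: "'k::field mpoly"
  assumes "p \<in> carrier (poly_ring n)" "p \<noteq> 0"
  shows "\<exists>x. (\<forall>i>n. x i = 0) \<and> eval_via (\<lambda>c. [:c:]) p x \<noteq> 0"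
proof -
  define N where "N = Suc (\<Sum>a\<in>Poly_Mapping.keys p. monomial_degree a)"
  define e where "e a = (\<Sum>i\<le>n. Poly_Mapping.lookup a i * N ^ i)" for a :: "nat \<Rightarrow>\<^sub>0 nat"
  define x :: "nat \<Rightarrow> 'k poly" where "x = (\<lambda>i. if i \<le> n then monom 1 (N ^ i) else 0)"
  have vars: "Poly_Mapping.keys a \<subseteq> {..n}" if "a \<in> Poly_Mapping.keys p" for a
    using assms(1) that by (simp add: poly_ring_def atLeast0AtMost)
  have small: "Poly_Mapping.lookup a i < N" if "a \<in> Poly_Mapping.keys p" for a i
  proof -
    have "monomial_degree a \<le> (\<Sum>a\<in>Poly_Mapping.keys p. monomial_degree a)"
      using that by (intro member_le_sum) auto
    then show ?thesis using lookup_le_monomial_degree[of a i] by (simp add: N_def)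
  qed
  have monval: "monomial_value x a = monom 1 (e a)" if "a \<in> Poly_Mapping.keys p" for a
  proof -
    have "monomial_value x a = monomial_value (\<lambda>i. monom 1 (N ^ i)) a"
      unfolding monomial_value_def using vars[OF that]
      by (intro prod.cong) (auto simp: x_def)
    also have "(\<Sum>i\<in>Poly_Mapping.keys a. Poly_Mapping.lookup a i * N ^ i) = e a"
      unfolding e_def using vars[OF that]
      by (intro sum.mono_neutral_left) (auto simp: in_keys_iff)
    then have "monomial_value (\<lambda>i. monom (1::'k) (N ^ i)) a = monom 1 (e a)"
      by (simp add: monomial_value_monom)
    finally show ?thesis .
  qed
  have inj: "a = b" if ab: "a \<in> Poly_Mapping.keys p" "b \<in> Poly_Mapping.keys p" "e a = e b" for a b
  proof (rule poly_mapping_eqI)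
    fix i
    show "Poly_Mapping.lookup a i = Poly_Mapping.lookup b i"
    proof (cases "i \<le> n")
      case True
      then show ?thesis
        using digits_unique[of "Poly_Mapping.lookup a" N "Poly_Mapping.lookup b" n i] small ab
        by (simp add: e_def)
    next
      case False
      then show ?thesis using vars ab(1,2) by (metis atMost_iff in_keys_iff subsetD)
    qed
  qed
  obtain a where a: "a \<in> Poly_Mapping.keys p"
    using assms(2) by (metis ex_in_conv keys_eq_empty)
  \<comment> \<open>Distinct monomials of \<open>p\<close> go to distinct powers of X, so nothing
    cancels and this coefficient is that of the monomial \<open>a\<close>.\<close>
  have "coeff (eval_via (\<lambda>c. [:c:]) p x) (e a) =
      (\<Sum>b\<in>Poly_Mapping.keys p. if b = a then Poly_Mapping.lookup p b else 0)"
    unfolding eval_via_def coeff_sum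
    using inj a by (intro sum.cong) (auto simp: monval)
  also have "\<dots> \<noteq> 0"
    using a by (simp add: in_keys_iff)
  finally have "eval_via (\<lambda>c. [:c:]) p x \<noteq> 0" by auto
  moreover have "\<forall>i>n. x i = 0" by (simp add: x_def)
  ultimately show ?thesis by blast
qed

interpretation const_hom: coefficient_hom "\<lambda>c. [:c::'k::field:]"
  by standard auto

interpretation const_const_hom: coefficient_hom "\<lambda>c. [:[:c::'k::field:]:]"
  by standard (auto simp: one_pCons)

interpretation id_hom: coefficient_hom "\<lambda>c::'k::field. c"
  by standard auto

text \<open>Evaluating at the linear polynomials a_i + y_i s restricts to a line by a ring
  homomorphism in \<open>p\<close>, through which membership in a power of an ideal becomes
  divisibility by a power of s.\<close>

lemma poly_eval_via_line:
  "poly (eval_via (\<lambda>c. [:[:c:]:]) p (\<lambda>i. [:a i, y i:])) s =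
     eval_via (\<lambda>c. [:c:]) p (\<lambda>i. a i + s * y i)"
  by (simp add: eval_via_def monomial_value_def poly_sum poly_prod)


section \<open>Powers of ideals of points\<close>

interpretation poly_ring: cring "poly_ring n :: 'k::field mpoly ring" for n
  by (rule cring_poly_ring)

abbreviation ideal_power :: "nat \<Rightarrow> 'k::field mpoly set \<Rightarrow> nat \<Rightarrow> 'k mpoly set" where
  "ideal_power n I m \<equiv> I [^]\<^bsub>ideals_set (poly_ring n)\<^esub> m"

lemma ideal_power_0: "ideal_power n I 0 = carrier (poly_ring n)"
  by (simp add: nat_pow_def ideals_set_def)

lemma ideal_power_Suc: "ideal_power n I (Suc m) = ideal_prod (poly_ring n) (ideal_power n I m) I"
  by (simp add: nat_pow_def ideals_set_def)

lemma ideal_ideal_power: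
  "ideal I (poly_ring n) \<Longrightarrow> ideal (ideal_power n I m) (poly_ring n)"
  by (induction m)
    (simp_all only: ideal_power_0 ideal_power_Suc poly_ring.oneideal poly_ring.ideal_prod_is_ideal)

lemma ideal_power_1: "ideal I (poly_ring n) \<Longrightarrow> ideal_power n I 1 = I"
  using poly_ring.ideal_prod_commute[OF poly_ring.oneideal, of I n] poly_ring.ideal_prod_one[of I n]
  unfolding One_nat_def ideal_power_Suc ideal_power_0 by simp

lemma ideal_power_add:
  assumes "ideal I (poly_ring n)"
  shows "ideal_power n I (a + b) = ideal_prod (poly_ring n) (ideal_power n I a) (ideal_power n I b)"
proof -
  interpret comm_monoid "ideals_set (poly_ring n :: 'a mpoly ring)"
    by (rule poly_ring.ideals_set_is_comm_monoid)
  have "I \<in> carrier (ideals_set (poly_ring n))"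
    using assms by (simp add: ideals_set_def)
  from nat_pow_mult[OF this, of a b] show ?thesis
    by (simp add: ideals_set_def)
qed

lemma ideal_power_antimono:
  assumes "ideal I (poly_ring n)" "b \<le> a"
  shows "ideal_power n I a \<subseteq> ideal_power n I b"
proof -
  obtain c where "a = b + c" using assms(2) le_Suc_ex by blast
  then show ?thesis
    using ideal_power_add[OF assms(1), of b c]
      poly_ring.ideal_prod_inter[OF ideal_ideal_power[OF assms(1)] ideal_ideal_power[OF assms(1)], of b c]
    by simp
qed

lemma mult_in_ideal_power:
  assumes "ideal I (poly_ring n)" "p \<in> ideal_power n I a" "q \<in> ideal_power n I b"
  shows "p * q \<in> ideal_power n I (a + b)"
  using ideal_prod.prod[OF assms(2,3), of "poly_ring n"] ideal_power_add[OF assms(1), of a b]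
  by (simp add: poly_ring_def)

lemma one_in_ideal_power_0: "1 \<in> ideal_power n I 0"
  using poly_ring.one_closed[of n] unfolding ideal_power_0 by (simp add: poly_ring_def)

lemma power_in_ideal_power:
  assumes "ideal I (poly_ring n)" "p \<in> ideal_power n I a"
  shows "p ^ k \<in> ideal_power n I (k * a)"
proof (induction k)
  case 0
  show ?case using one_in_ideal_power_0 by simp
next
  case (Suc k)
  then show ?case using mult_in_ideal_power[OF assms(1,2) Suc] by simp
qed

lemma prod_in_ideal_power:
  assumes "ideal I (poly_ring n)" "finite A" "\<And>j. j \<in> A \<Longrightarrow> f j \<in> ideal_power n I (k j)"
  shows "(\<Prod>j\<in>A. f j) \<in> ideal_power n I (\<Sum>j\<in>A. k j)"
  using assms(2,3)
proof (induction A rule: finite_induct)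
  case empty
  show ?case using one_in_ideal_power_0 by simp
next
  case (insert j A)
  then show ?case using mult_in_ideal_power[OF assms(1), of "f j" "k j"] by simp
qed

lemma homogeneous_one: "homogeneous_of_degree 0 1"
  by (simp add: homogeneous_of_degree_def monomial_degree_def)

lemma homogeneous_power: "homogeneous_of_degree d p \<Longrightarrow> homogeneous_of_degree (k * d) (p ^ k)"
  by (induction k) (auto simp: homogeneous_one dest: homogeneous_mult)

lemma homogeneous_prod:
  "finite A \<Longrightarrow> (\<And>j. j \<in> A \<Longrightarrow> homogeneous_of_degree (d j) (f j)) \<Longrightarrow>
    homogeneous_of_degree (\<Sum>j\<in>A. d j) (\<Prod>j\<in>A. f j)"
  by (induction A rule: finite_induct) (auto simp: homogeneous_one homogeneous_mult)

text \<open>The polynomials whose image under \<open>\<phi>\<close> is divisible by s form an ideal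
  \<open>K\<close> containing the generators, so a product of m elements of the generated ideal is
  sent to a multiple of s^m.\<close>

lemma ideal_power_vanishing:
  fixes \<phi> :: "'k::field mpoly \<Rightarrow> 'r::idom poly"
  assumes add: "\<And>p q. \<phi> (p + q) = \<phi> p + \<phi> q"
    and mult: "\<And>p q. \<phi> (p * q) = \<phi> p * \<phi> q"
    and zero: "\<phi> 0 = 0"
    and S: "S \<subseteq> carrier (poly_ring n)" "\<And>l. l \<in> S \<Longrightarrow> monom 1 1 dvd \<phi> l"
    and p: "p \<in> ideal_power n (genideal (poly_ring n) S) m"
  shows "monom 1 m dvd \<phi> p"
proof -
  let ?R = "poly_ring n :: 'k mpoly ring"
  let ?I = "genideal ?R S"
  define K where "K = {p \<in> carrier ?R. monom 1 1 dvd \<phi> p}"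
  have R_add: "a \<oplus>\<^bsub>?R\<^esub> b = a + b" and R_mult: "a \<otimes>\<^bsub>?R\<^esub> b = a * b" for a b
    by (simp_all add: poly_ring_def)
  have "ideal K ?R"
  proof (rule idealI)
    show "ring ?R" by (rule poly_ring.ring_axioms)
    show "subgroup K (add_monoid ?R)"
    proof (rule group.subgroupI)
      show "group (add_monoid ?R)" by (rule poly_ring.add.is_group)
      show "K \<subseteq> carrier (add_monoid ?R)" by (auto simp: K_def)
      have "0 \<in> K" using poly_ring.zero_closed[of n] by (simp add: K_def zero poly_ring_def)
      then show "K \<noteq> {}" by blast
      fix a assume a: "a \<in> K"
      \<comment> \<open>Negation is reduced to multiplication by -1, to which \<open>mult\<close>
        applies.\<close>
      then have "\<ominus>\<^bsub>?R\<^esub> a = \<ominus>\<^bsub>?R\<^esub> \<one>\<^bsub>?R\<^esub> * a"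
        using poly_ring.l_minus[of "\<one>\<^bsub>?R\<^esub>" n a] by (simp add: K_def R_mult[symmetric])
      moreover have "\<ominus>\<^bsub>?R\<^esub> a \<in> carrier ?R" using a by (simp add: K_def)
      ultimately have "\<ominus>\<^bsub>?R\<^esub> a \<in> K" using a by (simp add: K_def mult)
      then show "inv\<^bsub>add_monoid ?R\<^esub> a \<in> K" by (simp add: a_inv_def)
      fix b assume "b \<in> K"
      then have "a \<oplus>\<^bsub>?R\<^esub> b \<in> K"
        using a poly_ring.a_closed[of a n b] unfolding K_def by (auto simp: R_add add)
      then show "a \<otimes>\<^bsub>add_monoid ?R\<^esub> b \<in> K" by simp
    qed
  next
    fix a x assume "a \<in> K" "x \<in> carrier ?R"
    then show "x \<otimes>\<^bsub>?R\<^esub> a \<in> K" "a \<otimes>\<^bsub>?R\<^esub> x \<in> K"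
      using poly_ring.m_closed[of x n a] poly_ring.m_closed[of a n x]
      by (auto simp: K_def R_mult mult)
  qed
  moreover have "S \<subseteq> K" using S by (auto simp: K_def)
  ultimately have IK: "?I \<subseteq> K" by (rule poly_ring.genideal_minimal)
  have "\<forall>p \<in> ideal_power n ?I m. monom 1 m dvd \<phi> p"
  proof (induction m)
    case 0
    show ?case by (simp add: monom_0 one_pCons[symmetric])
  next
    case (Suc m)
    have "monom 1 (Suc m) dvd \<phi> p" if "p \<in> ideal_prod ?R (ideal_power n ?I m) ?I" for p
      using that
    proof (induction rule: ideal_prod.induct)
      case (prod i j)
      then have "monom 1 m dvd \<phi> i" "monom 1 1 dvd \<phi> j"
        using Suc IK by (auto simp: K_def)
      then have "monom 1 m * monom 1 1 dvd \<phi> i * \<phi> j" by (rule mult_dvd_mono)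
      then show ?case by (simp add: R_mult mult mult_monom)
    next
      case (sum s1 s2)
      then show ?case by (simp add: R_add add)
    qed
    then show ?case unfolding ideal_power_Suc by blast
  qed
  with p show ?thesis by blast
qed

lemma alpha_eqI:
  assumes "p \<in> I" "p \<noteq> 0" "homogeneous_of_degree d p"
    and "\<And>q d'. q \<in> I \<Longrightarrow> q \<noteq> 0 \<Longrightarrow> homogeneous_of_degree d' q \<Longrightarrow> d \<le> d'"
  shows "alpha I = d"
  unfolding alpha_def using assms by (intro Least_equality) auto

section \<open>Vectors representing the intersection points, over k and over k[X]\<close>

lemma poly_eval_smult:
  assumes "linear_form n l"
  shows "poly_eval l (\<lambda>i. c * x i) = c * poly_eval l x"
  by (simp add: poly_eval_eq id_hom.eval_via_linear_form[OF assms] sum_distrib_left mult_ac)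

lemma exists_intersection_vectors:
  assumes "0 < n" and "n < v" and proper: "proper_hyperplanes n v \<l> H"
  obtains P :: "nat set \<Rightarrow> nat \<Rightarrow> 'k::field" where
    "\<And>\<sigma> i. \<sigma> \<in> subsets_of_size n v \<Longrightarrow> n < i \<Longrightarrow> P \<sigma> i = 0"
    "\<And>\<sigma>. \<sigma> \<in> subsets_of_size n v \<Longrightarrow> \<exists>i. P \<sigma> i \<noteq> 0"
    "\<And>\<sigma> j. \<sigma> \<in> subsets_of_size n v \<Longrightarrow> j \<in> {1..v} \<Longrightarrow> poly_eval (\<l> j) (P \<sigma>) = 0 \<longleftrightarrow> j \<in> \<sigma>"
    "\<And>\<sigma> x. \<sigma> \<in> subsets_of_size n v \<Longrightarrow> (\<And>i. n < i \<Longrightarrow> x i = 0) \<Longrightarrow>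
      (\<And>j. j \<in> \<sigma> \<Longrightarrow> poly_eval (\<l> j) x = 0) \<Longrightarrow> \<exists>c. x = (\<lambda>i. c * P \<sigma> i)"
proof -
  define point where "point x = {(\<lambda>i. c * x i) | c. c \<noteq> 0}" for x :: "nat \<Rightarrow> 'k"
  have lin: "linear_form n (\<l> j)" and H: "H j = hyperplane n (\<l> j)" if "j \<in> {1..v}" for j
    using proper that by (auto simp: proper_hyperplanes_def)
  have self: "x \<in> point x" for x
    unfolding point_def by (auto intro: exI[of _ 1])
  have point_H: "point x \<in> H j \<longleftrightarrow> poly_eval (\<l> j) x = 0"
    if "j \<in> {1..v}" "\<forall>i>n. x i = 0" "\<exists>i. x i \<noteq> 0" for j x
  proof -
    have "point x \<in> proj_space n" using that(2,3) by (auto simp: proj_space_def point_def)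
    then have "point x \<in> H j \<longleftrightarrow> (\<forall>y\<in>point x. poly_eval (\<l> j) y = 0)"
      by (simp add: H[OF that(1)] hyperplane_def)
    also have "\<dots> \<longleftrightarrow> poly_eval (\<l> j) x = 0"
      using self[of x] by (auto simp: point_def poly_eval_smult[OF lin[OF that(1)]])
    finally show ?thesis .
  qed
  have "\<exists>x. (\<Inter>i\<in>\<sigma>. H i) = {point x} \<and> (\<forall>i>n. x i = 0) \<and> (\<exists>i. x i \<noteq> 0)"
    if \<sigma>: "\<sigma> \<in> subsets_of_size n v" for \<sigma>
  proof -
    obtain Q where Q: "(\<Inter>i\<in>\<sigma>. H i) = {Q}"
      using proper \<sigma> by (auto simp: proper_hyperplanes_def)
    obtain j where j: "j \<in> \<sigma>"
      using \<sigma> assms(1) by (cases "\<sigma> = {}") (auto simp: subsets_of_size_def)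
    then have "j \<in> {1..v}" using \<sigma> by (auto simp: subsets_of_size_def)
    moreover have "Q \<in> H j" using Q j by blast
    ultimately have "Q \<in> proj_space n" by (simp add: H hyperplane_def)
    then show ?thesis using Q by (auto simp: proj_space_def point_def)
  qed
  then obtain P where P: "\<And>\<sigma>. \<sigma> \<in> subsets_of_size n v \<Longrightarrow> (\<Inter>i\<in>\<sigma>. H i) = {point (P \<sigma>)}"
    "\<And>\<sigma>. \<sigma> \<in> subsets_of_size n v \<Longrightarrow> \<forall>i>n. P \<sigma> i = 0"
    "\<And>\<sigma>. \<sigma> \<in> subsets_of_size n v \<Longrightarrow> \<exists>i. P \<sigma> i \<noteq> 0"
    by metis
  have sub: "j \<in> {1..v}" if "\<sigma> \<in> subsets_of_size n v" "j \<in> \<sigma>" for \<sigma> j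
    using that by (auto simp: subsets_of_size_def)
  show ?thesis
  proof (rule that[of P])
    fix \<sigma> j assume \<sigma>: "\<sigma> \<in> subsets_of_size n v" and j: "j \<in> {1..v}"
    show "poly_eval (\<l> j) (P \<sigma>) = 0 \<longleftrightarrow> j \<in> \<sigma>"
    proof
      assume "j \<in> \<sigma>"
      then have "point (P \<sigma>) \<in> H j" using P(1)[OF \<sigma>] by blast
      then show "poly_eval (\<l> j) (P \<sigma>) = 0" using point_H[OF j P(2,3)[OF \<sigma>]] by simp
    next
      assume "poly_eval (\<l> j) (P \<sigma>) = 0"
      then have Hj: "point (P \<sigma>) \<in> H j" using point_H[OF j P(2,3)[OF \<sigma>]] by simp
      show "j \<in> \<sigma>"
      proof (rule ccontr)
        assume nj: "j \<notin> \<sigma>"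
        have fin: "finite \<sigma>" "card \<sigma> = n" "\<sigma> \<subseteq> {1..v}"
          using \<sigma> finite_subset[of \<sigma> "{1..v}"] by (auto simp: subsets_of_size_def)
        obtain i where i: "i \<in> \<sigma>" using fin assms(1) by fastforce
        \<comment> \<open>Exchanging one index of \<open>\<sigma>\<close> for \<open>j\<close> gives
          another n-set with the same intersection point, against the injectivity in
          \<open>proper_hyperplanes\<close>.\<close>
        define \<rho> where "\<rho> = insert j (\<sigma> - {i})"
        have \<rho>: "\<rho> \<in> subsets_of_size n v"
          using fin nj j card_Suc_Diff1[OF fin(1) i] by (auto simp: \<rho>_def subsets_of_size_def)
        have "point (P \<sigma>) \<in> (\<Inter>i\<in>\<rho>. H i)"
          using Hj P(1)[OF \<sigma>] by (auto simp: \<rho>_def)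
        then have "(\<Inter>i\<in>\<rho>. H i) = (\<Inter>i\<in>\<sigma>. H i)"
          using P(1)[OF \<sigma>] P(1)[OF \<rho>] by auto
        then have "\<rho> = \<sigma>"
          using proper \<sigma> \<rho> by (auto simp: proper_hyperplanes_def inj_on_def)
        then show False using nj by (auto simp: \<rho>_def)
      qed
    qed
  next
    fix \<sigma> and x :: "nat \<Rightarrow> 'k"
    assume \<sigma>: "\<sigma> \<in> subsets_of_size n v" and x: "\<And>i. n < i \<Longrightarrow> x i = 0"
      "\<And>j. j \<in> \<sigma> \<Longrightarrow> poly_eval (\<l> j) x = 0"
    show "\<exists>c. x = (\<lambda>i. c * P \<sigma> i)"
    proof (cases "\<exists>i. x i \<noteq> 0")
      case True
      then have "point x \<in> (\<Inter>i\<in>\<sigma>. H i)"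
        using point_H[OF sub[OF \<sigma>]] x by blast
      then have "x \<in> point (P \<sigma>)" using P(1)[OF \<sigma>] self[of x] by simp
      then show ?thesis by (auto simp: point_def)
    next
      case False
      then show ?thesis by (intro exI[of _ 0]) auto
    qed
  qed (use P in auto)
qed

text \<open>The forms have coefficients in k, so a vector over k[X] is a common zero exactly if each
  of its coefficient vectors is one. Nonzero constants are units of k[X], which gives the unit
  condition.\<close>

lemma linear_forms_of_intersection_vectors:
  fixes P :: "nat set \<Rightarrow> nat \<Rightarrow> 'k::field"
  assumes "n < v"
    and lin: "\<And>j. j \<in> {1..v} \<Longrightarrow> linear_form n (\<l> j)"
    and P: "\<And>\<sigma> i. \<sigma> \<in> subsets_of_size n v \<Longrightarrow> n < i \<Longrightarrow> P \<sigma> i = 0"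
    "\<And>\<sigma>. \<sigma> \<in> subsets_of_size n v \<Longrightarrow> \<exists>i. P \<sigma> i \<noteq> 0"
    "\<And>\<sigma> j. \<sigma> \<in> subsets_of_size n v \<Longrightarrow> j \<in> {1..v} \<Longrightarrow> poly_eval (\<l> j) (P \<sigma>) = 0 \<longleftrightarrow> j \<in> \<sigma>"
    "\<And>\<sigma> x. \<sigma> \<in> subsets_of_size n v \<Longrightarrow> (\<And>i. n < i \<Longrightarrow> x i = 0) \<Longrightarrow>
      (\<And>j. j \<in> \<sigma> \<Longrightarrow> poly_eval (\<l> j) x = 0) \<Longrightarrow> \<exists>c. x = (\<lambda>i. c * P \<sigma> i)"
  shows "linear_forms n v (\<lambda>j. eval_via (\<lambda>c. [:c:]) (\<l> j)) (\<lambda>\<sigma> i. [:P \<sigma> i:])"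
proof
  have sub: "j \<in> {1..v}" if "\<sigma> \<in> subsets_of_size n v" "j \<in> \<sigma>" for \<sigma> j
    using that by (auto simp: subsets_of_size_def)
  have at_P: "eval_via (\<lambda>c. [:c:]) (\<l> j) (\<lambda>i. [:x i:]) = [:poly_eval (\<l> j) x:]"
    if "j \<in> {1..v}" for j x
  proof -
    have "(\<Sum>i\<in>A. [:f i:]) = [:\<Sum>i\<in>A. f i:]" for A :: "nat set" and f :: "nat \<Rightarrow> 'k"
      by (induction A rule: infinite_finite_induct) auto
    then show ?thesis
      by (simp add: poly_eval_eq const_hom.eval_via_linear_form[OF lin[OF that]]
          id_hom.eval_via_linear_form[OF lin[OF that]] mult.commute)
  qed
  show "infinite (UNIV :: 'k poly set)" by (rule infinite_UNIV_poly)
  show "n < v" by fact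
  show "form 1 (eval_via (\<lambda>c. [:c:]) (\<l> j))" if "j \<in> {1..v}" for j
    using lin[OF that] by (intro form_eval_via) (simp add: linear_form_def)
  show "eval_via (\<lambda>c. [:c:]) (\<l> j) (\<lambda>i. x i + s * y i) =
      eval_via (\<lambda>c. [:c:]) (\<l> j) x + s * eval_via (\<lambda>c. [:c:]) (\<l> j) y"
    if "j \<in> {1..v}" for j x y s
    unfolding const_hom.eval_via_linear_form[OF lin[OF that]]
    by (simp add: algebra_simps smult_add_right sum.distrib sum_distrib_left)
  show "[:P \<sigma> i:] = 0" if "\<sigma> \<in> subsets_of_size n v" "n < i" for \<sigma> i
    using P(1)[OF that] by simp
  show "eval_via (\<lambda>c. [:c:]) (\<l> j) (\<lambda>i. [:P \<sigma> i:]) = 0"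
    if "\<sigma> \<in> subsets_of_size n v" "j \<in> \<sigma>" for \<sigma> j
    using at_P[OF sub[OF that]] P(3)[OF that(1) sub[OF that]] that by simp
  show "eval_via (\<lambda>c. [:c:]) (\<l> j) (\<lambda>i. [:P \<sigma> i:]) dvd 1"
    if "\<sigma> \<in> subsets_of_size n v" "j \<in> {1..v} - \<sigma>" for \<sigma> j
    using at_P[of j "P \<sigma>"] P(3)[OF that(1), of j] that(2) by (simp add: is_unit_const_poly_iff dvd_field_iff)
  show "\<exists>c. x = (\<lambda>i. c * [:P \<sigma> i:])"
    if \<sigma>: "\<sigma> \<in> subsets_of_size n v" and x: "\<And>i. n < i \<Longrightarrow> x i = 0"
      "\<And>j. j \<in> \<sigma> \<Longrightarrow> eval_via (\<lambda>c. [:c:]) (\<l> j) x = 0" for \<sigma> and x :: "nat \<Rightarrow> 'k poly"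
  proof -
    have coeffs: "\<exists>c. (\<lambda>i. coeff (x i) k) = (\<lambda>i. c * P \<sigma> i)" for k
    proof (rule P(4)[OF \<sigma>])
      fix j assume j: "j \<in> \<sigma>"
      have "poly_eval (\<l> j) (\<lambda>i. coeff (x i) k) = coeff (eval_via (\<lambda>c. [:c:]) (\<l> j) x) k"
        by (simp add: poly_eval_eq const_hom.eval_via_linear_form[OF lin[OF sub[OF \<sigma> j]]]
            id_hom.eval_via_linear_form[OF lin[OF sub[OF \<sigma> j]]] coeff_sum)
      then show "poly_eval (\<l> j) (\<lambda>i. coeff (x i) k) = 0" using x(2)[OF j] by simp
    qed (use x(1) in simp)
    \<comment> \<open>A nonzero coordinate fixes the multiplier of every coefficient vector, so the
      multipliers combine into one polynomial.\<close>
    obtain i0 where i0: "P \<sigma> i0 \<noteq> 0" using P(2)[OF \<sigma>] by blast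
    have "x i = smult (1 / P \<sigma> i0) (x i0) * [:P \<sigma> i:]" for i
    proof (rule poly_eqI)
      fix k
      obtain c where "(\<lambda>i. coeff (x i) k) = (\<lambda>i. c * P \<sigma> i)" using coeffs by blast
      then have "coeff (x i) k = c * P \<sigma> i" "coeff (x i0) k = c * P \<sigma> i0" by meson+
      then show "coeff (x i) k = coeff (smult (1 / P \<sigma> i0) (x i0) * [:P \<sigma> i:]) k"
        using i0 by (simp add: field_simps)
    qed
    then show ?thesis by blast
  qed
qed

lemma proper_hyperplanes_linear_forms:
  assumes "0 < n" and "n < v" and proper: "proper_hyperplanes n v \<l> H"
  obtains P :: "nat set \<Rightarrow> nat \<Rightarrow> 'k::field" where
    "linear_forms n v (\<lambda>j. eval_via (\<lambda>c. [:c:]) (\<l> j)) (\<lambda>\<sigma> i. [:P \<sigma> i:])"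
proof (rule exists_intersection_vectors[OF assms])
  have lin: "linear_form n (\<l> j)" if "j \<in> {1..v}" for j
    using proper that by (auto simp: proper_hyperplanes_def)
  fix P :: "nat set \<Rightarrow> nat \<Rightarrow> 'k"
  assume "\<And>\<sigma> i. \<sigma> \<in> subsets_of_size n v \<Longrightarrow> n < i \<Longrightarrow> P \<sigma> i = 0"
    "\<And>\<sigma>. \<sigma> \<in> subsets_of_size n v \<Longrightarrow> \<exists>i. P \<sigma> i \<noteq> 0"
    "\<And>\<sigma> j. \<sigma> \<in> subsets_of_size n v \<Longrightarrow> j \<in> {1..v} \<Longrightarrow> poly_eval (\<l> j) (P \<sigma>) = 0 \<longleftrightarrow> j \<in> \<sigma>"
    "\<And>\<sigma> x. \<sigma> \<in> subsets_of_size n v \<Longrightarrow> (\<And>i. n < i \<Longrightarrow> x i = 0) \<Longrightarrow>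
      (\<And>j. j \<in> \<sigma> \<Longrightarrow> poly_eval (\<l> j) x = 0) \<Longrightarrow> \<exists>c. x = (\<lambda>i. c * P \<sigma> i)"
  from that[OF linear_forms_of_intersection_vectors[OF \<open>n < v\<close> lin this]]
  show thesis .
qed


section \<open>Symbolic powers of the complement of a Steiner configuration\<close>

lemma linear_form_in_carrier: "linear_form n l \<Longrightarrow> l \<in> carrier (poly_ring n)"
  by (simp add: linear_form_def)

lemma point_ideal_facts:
  assumes "\<And>j. j \<in> \<sigma> \<Longrightarrow> linear_form n (\<l> j)"
  shows ideal_point_ideal: "ideal (point_ideal n \<l> \<sigma>) (poly_ring n)"
    and linear_form_in_point_ideal: "j \<in> \<sigma> \<Longrightarrow> \<l> j \<in> point_ideal n \<l> \<sigma>"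
proof -
  have sub: "\<l> ` \<sigma> \<subseteq> carrier (poly_ring n)"
    using assms linear_form_in_carrier by auto
  show "ideal (point_ideal n \<l> \<sigma>) (poly_ring n)"
    unfolding point_ideal_def by (rule poly_ring.genideal_ideal[OF sub])
  show "\<l> j \<in> point_ideal n \<l> \<sigma>" if "j \<in> \<sigma>"
    unfolding point_ideal_def using poly_ring.genideal_self[OF sub] that by auto
qed

lemma prod_linear_forms_in_symbolic_power:
  assumes lin: "\<And>j. j \<in> {1..v} \<Longrightarrow> linear_form n (\<l> j)"
    and C: "C \<subseteq> subsets_of_size n v"
    and mult: "\<And>\<sigma>. \<sigma> \<in> C \<Longrightarrow> m \<le> (\<Sum>j\<in>\<sigma>. k j)"
  shows "(\<Prod>j\<in>{1..v}. \<l> j ^ k j) \<in> symbolic_power n \<l> C m"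
proof -
  let ?p = "\<Prod>j\<in>{1..v}. \<l> j ^ k j"
  \<comment> \<open>Exponent 0 turns the product lemmas for ideal powers into closure of the ring
    under products.\<close>
  have "\<l> j \<in> ideal_power n (carrier (poly_ring n)) 0" if "j \<in> {1..v}" for j
    unfolding ideal_power_0 using lin[OF that] by (rule linear_form_in_carrier)
  then have "?p \<in> ideal_power n (carrier (poly_ring n)) (\<Sum>j\<in>{1..v}. k j * 0)"
    by (intro prod_in_ideal_power power_in_ideal_power poly_ring.oneideal) simp_all
  then have "?p \<in> carrier (poly_ring n)"
    unfolding mult_0_right sum.neutral_const ideal_power_0 .
  moreover have "?p \<in> ideal_power n (point_ideal n \<l> \<sigma>) m" if "\<sigma> \<in> C" for \<sigma>
  proof -
    have \<sigma>: "\<sigma> \<subseteq> {1..v}" using that C by (auto simp: subsets_of_size_def)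
    then have lin\<sigma>: "linear_form n (\<l> j)" if "j \<in> \<sigma>" for j using lin that by blast
    let ?I = "point_ideal n \<l> \<sigma>"
    have I: "ideal ?I (poly_ring n)" using lin\<sigma> by (rule ideal_point_ideal)
    have "\<l> j \<in> ideal_power n ?I (if j \<in> \<sigma> then 1 else 0)" if "j \<in> {1..v}" for j
    proof (cases "j \<in> \<sigma>")
      case True
      then show ?thesis
        using linear_form_in_point_ideal[where j = j, OF lin\<sigma>] by (simp only: ideal_power_1[OF I] if_True)
    next
      case False
      then show ?thesis
        using linear_form_in_carrier[OF lin[OF that]] by (simp only: ideal_power_0 if_False)
    qed
    then have "?p \<in> ideal_power n ?I (\<Sum>j\<in>{1..v}. k j * (if j \<in> \<sigma> then 1 else 0))"
      by (intro prod_in_ideal_power[OF I] power_in_ideal_power[OF I]) auto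
    also have "(\<Sum>j\<in>{1..v}. k j * (if j \<in> \<sigma> then 1 else 0)) = (\<Sum>j\<in>\<sigma>. k j)"
      using \<sigma> by (intro sum.mono_neutral_cong_right) auto
    finally show ?thesis
      using ideal_power_antimono[OF I mult[OF that]] by blast
  qed
  ultimately show ?thesis by (simp add: symbolic_power_def)
qed

lemma symbolic_power_1:
  assumes lin: "\<And>j. j \<in> {1..v} \<Longrightarrow> linear_form n (\<l> j)"
    and C: "C \<subseteq> subsets_of_size n v"
  shows "symbolic_power n \<l> C 1 = config_ideal n \<l> C"
proof -
  have "ideal_power n (point_ideal n \<l> \<sigma>) 1 = point_ideal n \<l> \<sigma>" if "\<sigma> \<in> C" for \<sigma>
  proof (rule ideal_power_1[OF ideal_point_ideal])
    fix j assume "j \<in> \<sigma>"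
    moreover have "\<sigma> \<subseteq> {1..v}" using that C by (auto simp: subsets_of_size_def)
    ultimately have "j \<in> {1..v}" by blast
    then show "linear_form n (\<l> j)" by (rule lin)
  qed
  then show ?thesis by (simp add: symbolic_power_def config_ideal_def)
qed

lemma alpha_symbolic_power:
  fixes \<l> :: "nat \<Rightarrow> 'k::field mpoly"
  assumes n: "2 \<le> n" and v: "v = n + e" "2 \<le> e"
    and B: "B \<subseteq> subsets_of_size n v" "\<beta> \<in> B"
    and packing: "\<And>\<beta> \<beta>' \<tau>. \<beta> \<in> B \<Longrightarrow> \<beta>' \<in> B \<Longrightarrow> card \<tau> = n - 1 \<Longrightarrow> \<tau> \<subseteq> \<beta> \<Longrightarrow> \<tau> \<subseteq> \<beta>' \<Longrightarrow> \<beta> = \<beta>'"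
    and C: "C = subsets_of_size n v - B"
    and proper: "proper_hyperplanes n v \<l> H"
  shows "alpha (symbolic_power n \<l> C m) = degree_bound e n m"
proof -
  define p q where "p = m div n" and "q = m mod n"
  have m: "m = p * n + q" and q: "q < n" using n by (auto simp: p_def q_def)
  have lin: "linear_form n (\<l> j)" if "j \<in> {1..v}" for j
    using proper that by (auto simp: proper_hyperplanes_def)
  have CS: "C \<subseteq> subsets_of_size n v" using C by simp
  have \<beta>: "\<beta> \<subseteq> {1..v}" "card \<beta> = n" "finite \<beta>"
    using B finite_subset[of \<beta> "{1..v}"] by (auto simp: subsets_of_size_def)
  have \<sigma>: "\<sigma> \<subseteq> {1..v}" "card \<sigma> = n" "finite \<sigma>" if "\<sigma> \<in> C" for \<sigma>
    using CS that finite_subset[of \<sigma> "{1..v}"] by (auto simp: subsets_of_size_def)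
  \<comment> \<open>\<open>S\<close> lists the forms used once more than the p copies of every form;
    it has to meet each set of \<open>C\<close> in at least q indices.\<close>
  have "\<exists>S \<subseteq> {1..v}. card S = (if q = 0 then 0 else if q = 1 then e else e + q) \<and>
      (\<forall>\<sigma>\<in>C. q \<le> card (S \<inter> \<sigma>))"
  proof -
    consider "q = 0" | "q = 1" | "2 \<le> q" by linarith
    then show ?thesis
    proof cases
      case 1
      then show ?thesis by (intro exI[of _ "{}"]) auto
    next
      case 2
      have "1 \<le> card (({1..v} - \<beta>) \<inter> \<sigma>)" if "\<sigma> \<in> C" for \<sigma>
      proof -
        have "\<sigma> \<noteq> \<beta>" using that B(2) C by auto
        then have "\<not> \<sigma> \<subseteq> \<beta>" using \<sigma>[OF that] \<beta> card_subset_eq by metis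
        then have "({1..v} - \<beta>) \<inter> \<sigma> \<noteq> {}" using \<sigma>[OF that] by blast
        then show ?thesis using \<sigma>[OF that] by (simp add: Suc_le_eq card_gt_0_iff)
      qed
      moreover have "card ({1..v} - \<beta>) = e"
        using \<beta> v by (simp add: card_Diff_subset)
      ultimately show ?thesis using 2 by (intro exI[of _ "{1..v} - \<beta>"]) auto
    next
      case 3
      \<comment> \<open>Only n - q indices lie outside \<open>{1..e + q}\<close>, so an n-set has at
        least q inside.\<close>
      have "q \<le> card ({1..e + q} \<inter> \<sigma>)" if "\<sigma> \<in> C" for \<sigma>
      proof -
        have "card ({1..e + q} \<union> \<sigma>) \<le> card {1..v}"
          using \<sigma>[OF that] v q by (intro card_mono) auto
        then show ?thesis
          using card_Un_Int[of "{1..e + q}" \<sigma>] \<sigma>[OF that] v by simp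
      qed
      then show ?thesis using 3 v q by (intro exI[of _ "{1..e + q}"]) auto
    qed
  qed
  then obtain S where S: "S \<subseteq> {1..v}"
    "card S = (if q = 0 then 0 else if q = 1 then e else e + q)"
    "\<And>\<sigma>. \<sigma> \<in> C \<Longrightarrow> q \<le> card (S \<inter> \<sigma>)" by blast
  define k where "k j = p + (if j \<in> S then 1 else 0)" for j
  have sum_k: "(\<Sum>j\<in>A. k j) = card A * p + card (S \<inter> A)" if "finite A" for A
    using that by (simp add: k_def sum.distrib sum.If_cases Int_commute)
  let ?p = "\<Prod>j\<in>{1..v}. \<l> j ^ k j"
  have hom: "homogeneous_of_degree (\<Sum>j\<in>{1..v}. k j * 1) ?p"
    using lin by (intro homogeneous_prod homogeneous_power) (auto simp: linear_form_def)
  have "S \<inter> {1..v} = S" using S(1) by blast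
  then have "(\<Sum>j\<in>{1..v}. k j) = v * p + card S"
    using sum_k[of "{1..v}"] by simp
  also have "\<dots> = degree_bound e n m"
    unfolding m degree_bound_eq[OF n q] S(2) v(1) by simp
  finally have deg: "(\<Sum>j\<in>{1..v}. k j) = degree_bound e n m" .
  have "0 < n" "n < v" using n v by simp_all
  then obtain P where
    "linear_forms n v (\<lambda>j. eval_via (\<lambda>c. [:c:]) (\<l> j)) (\<lambda>\<sigma> i. [:P \<sigma> i:])"
    using proper_hyperplanes_linear_forms[OF _ _ proper] by blast
  then interpret linear_forms n v "\<lambda>j. eval_via (\<lambda>c. [:c:]) (\<l> j)" "\<lambda>\<sigma> i. [:P \<sigma> i:]" .
  show ?thesis
  proof (rule alpha_eqI)
    show "?p \<in> symbolic_power n \<l> C m"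
    proof (rule prod_linear_forms_in_symbolic_power[OF lin CS])
      fix \<sigma> assume "\<sigma> \<in> C"
      then show "m \<le> (\<Sum>j\<in>\<sigma>. k j)"
        using sum_k[of \<sigma>] \<sigma>[of \<sigma>] S(3)[of \<sigma>] m by (simp add: mult.commute)
    qed
    show "?p \<noteq> 0" using lin by (auto simp: linear_form_def)
    show "homogeneous_of_degree (degree_bound e n m) ?p"
      using hom deg by simp
  next
    fix f d assume f: "f \<in> symbolic_power n \<l> C m" "f \<noteq> 0" "homogeneous_of_degree d f"
    let ?F = "eval_via (\<lambda>c. [:c:]) f"
    have "f \<in> carrier (poly_ring n)" using f(1) by (simp add: symbolic_power_def)
    \<comment> \<open>Passing to k[X] matters here: over a finite field a nonzero polynomial may
      vanish at every vector.\<close>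
    then have nz: "\<exists>x\<in>flat {}. ?F x \<noteq> 0"
      using exists_nonzero_value[OF _ f(2)] by (auto simp: flat_def)
    have "vanishes_to_order m ?F (flat {}) (\<lambda>i. [:P \<sigma> i:])" if "\<sigma> \<in> C" for \<sigma>
      unfolding vanishes_to_order_def
    proof
      fix y
      \<comment> \<open>This is the restriction to the line through the point in direction y, as a
        polynomial in s; each generator of the point ideal has constant term 0 there.\<close>
      let ?\<phi> = "\<lambda>g. eval_via (\<lambda>c. [:[:c:]:]) g (\<lambda>i. [:[:P \<sigma> i:], y i:])"
      have "monom 1 m dvd ?\<phi> f"
      proof (rule ideal_power_vanishing)
        show "f \<in> ideal_power n (genideal (poly_ring n) (\<l> ` \<sigma>)) m"
          using f(1) that by (auto simp: symbolic_power_def point_ideal_def)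
        show "\<l> ` \<sigma> \<subseteq> carrier (poly_ring n)"
          using \<sigma>(1)[OF that] lin linear_form_in_carrier by blast
        fix l assume "l \<in> \<l> ` \<sigma>"
        then obtain j where j: "j \<in> \<sigma>" "l = \<l> j" by blast
        have "poly (?\<phi> l) 0 = 0"
          using L_P[of \<sigma> j] j CS that by (subst poly_eval_via_line) auto
        then show "monom 1 1 dvd ?\<phi> l"
          by (simp add: monom_1_dvd_iff' poly_0_coeff_0)
      qed (rule const_const_hom.eval_via_add const_const_hom.eval_via_mult
          const_const_hom.eval_via_0)+
      then show "\<exists>p. (\<forall>s. ?F (\<lambda>i. [:P \<sigma> i:] + s * y i) = poly p s) \<and> monom 1 m dvd p"
        using poly_eval_via_line[of f "\<lambda>i. [:P \<sigma> i:]" y, symmetric] by blast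
    qed
    \<comment> \<open>The whole space is the flat of the empty set, so the bound is taken at r =
      n.\<close>
    then show "degree_bound e n m \<le> d"
      using n by (intro degree_lower_bound[OF v packing C _ _ _ form_eval_via[OF f(3)] nz]) auto
  qed
qed

section \<open>Combinatorial consequences of the Steiner property\<close>

lemma steiner_system_packing:
  assumes "steiner_system t n v B" "t \<le> card \<tau>" "\<beta> \<in> B" "\<beta>' \<in> B" "\<tau> \<subseteq> \<beta>" "\<tau> \<subseteq> \<beta>'"
  shows "\<beta> = \<beta>'"
proof -
  obtain T where T: "T \<subseteq> \<tau>" "card T = t"
    using assms(2) obtain_subset_with_card_n by metis
  have "\<beta> \<subseteq> {1..v}"
    using assms(1,3) by (auto simp: steiner_system_def subsets_of_size_def)
  then have "T \<subseteq> {1..v}" using T(1) assms(5) by blast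
  then have "\<exists>!\<beta>. \<beta> \<in> B \<and> T \<subseteq> \<beta>"
    using T assms(1) by (auto simp: steiner_system_def subsets_of_size_def)
  then show ?thesis using assms T by (metis subset_trans)
qed

text \<open>For v = n the only n-set is a block, so the complement is empty. For v = n + 1 two
  blocks meet in at least n - 1 >= t elements and coincide; yet a block misses some y, and t >= 1
  provides a block through y.\<close>

lemma steiner_system_size:
  assumes "1 \<le> t" "t < n" "n \<le> v" and steiner: "steiner_system t n v B"
    and "subsets_of_size n v - B \<noteq> {}"
  shows "B \<noteq> {}" and "n + 2 \<le> v"
proof -
  have block: "\<exists>\<beta>. \<beta> \<in> B \<and> T \<subseteq> \<beta>" if "T \<subseteq> {1..v}" "card T = t" for T
    using steiner that unfolding steiner_system_def subsets_of_size_def by blast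
  have sub: "\<beta> \<subseteq> {1..v}" "card \<beta> = n" if "\<beta> \<in> B" for \<beta>
    using steiner that by (auto simp: steiner_system_def subsets_of_size_def)
  obtain \<beta> where \<beta>: "\<beta> \<in> B"
    using block[of "{1..t}"] assms(1-3) by auto
  then show "B \<noteq> {}" by blast
  have "v \<noteq> n"
  proof
    assume "v = n"
    then have "\<sigma> = {1..v}" if "\<sigma> \<in> subsets_of_size n v" for \<sigma>
      using that card_subset_eq[of "{1..v}" \<sigma>] by (auto simp: subsets_of_size_def)
    moreover have "\<beta> \<in> subsets_of_size n v" using sub[OF \<beta>] by (simp add: subsets_of_size_def)
    ultimately show False using assms(5) \<beta> by blast
  qed
  moreover have "v \<noteq> n + 1"
  proof
    assume v: "v = n + 1"
    have "card \<beta> \<noteq> card {1..v}" using sub[OF \<beta>] v by simp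
    then have "\<beta> \<noteq> {1..v}" by blast
    then obtain y where y: "y \<in> {1..v}" "y \<notin> \<beta>" using sub[OF \<beta>] by blast
    have "\<exists>T. {y} \<subseteq> T \<and> T \<subseteq> {1..v} \<and> card T = t"
      using y assms(1-3) by (intro exists_subset_between) auto
    then obtain \<beta>' where \<beta>': "\<beta>' \<in> B" "y \<in> \<beta>'" using block by blast
    have "card (\<beta> \<union> \<beta>') \<le> card {1..v}"
      using sub \<beta> \<beta>'(1) by (intro card_mono) auto
    moreover have "finite \<beta>" "finite \<beta>'"
      using sub \<beta> \<beta>'(1) finite_subset[of _ "{1..v}"] by auto
    ultimately have "t \<le> card (\<beta> \<inter> \<beta>')"
      using card_Un_Int[of \<beta> \<beta>'] sub(2) \<beta> \<beta>'(1) v assms(2) by simp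
    then have "\<beta> = \<beta>'"
      using steiner_system_packing[OF steiner _ \<beta> \<beta>'(1)] by simp
    then show False using y \<beta>'(2) by simp
  qed
  ultimately show "n + 2 \<le> v" using assms(3) by linarith
qed

theorem theorem3p9:
  fixes t n v :: nat
    and B C :: "nat set set"
    and \<l> :: "nat \<Rightarrow> 'k::field mpoly"
    and H :: "nat \<Rightarrow> (nat \<Rightarrow> 'k) set set"
  assumes "1 \<le> t" and "t < n" and "n \<le> v"
    and "steiner_system t n v B"
    and "C = subsets_of_size n v - B"
    and "C \<noteq> {}"
    and "proper_hyperplanes n v \<l> H"
  shows "alpha (config_ideal n \<l> C) = v - n \<and>
    (\<forall>q. 2 \<le> q \<and> q < n \<longrightarrow> alpha (symbolic_power n \<l> C q) = v - n + q) \<and>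
    (\<forall>m p q. m = p * n + q \<and> q < n \<longrightarrow>
       alpha (symbolic_power n \<l> C m) = alpha (symbolic_power n \<l> C q) + p * v) \<and>
    alpha (symbolic_power n \<l> C n) = alpha (symbolic_power n \<l> C 0) + v \<and>
    alpha (symbolic_power n \<l> C 0) + v = v"
proof -
  have n: "2 \<le> n" using assms(1,2) by linarith
  have size: "B \<noteq> {}" "n + 2 \<le> v"
    using steiner_system_size[OF assms(1-4)] assms(5,6) by simp_all
  obtain e where e: "v = n + e" using assms(3) le_Suc_ex by blast
  obtain \<beta> where \<beta>: "\<beta> \<in> B" using size(1) by blast
  have "alpha (symbolic_power n \<l> C m) = degree_bound e n m" for m
  proof (rule alpha_symbolic_power[OF n e _ _ \<beta> _ assms(5,7)])
    show "B \<subseteq> subsets_of_size n v" using assms(4) by (simp add: steiner_system_def)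
    show "\<beta> = \<beta>'" if "\<beta> \<in> B" "\<beta>' \<in> B" "card \<tau> = n - 1" "\<tau> \<subseteq> \<beta>" "\<tau> \<subseteq> \<beta>'" for \<beta> \<beta>' \<tau>
      using steiner_system_packing[OF assms(4) _ that(1,2,4,5)] that(3) assms(2) by simp
  qed (use size e in simp)
  then have alpha: "alpha (symbolic_power n \<l> C (p * n + q)) =
      p * v + (if q = 0 then 0 else if q = 1 then e else e + q)" if "q < n" for p q
    using degree_bound_eq[OF n that] e by simp
  \<comment> \<open>Part (i) is the first symbolic power, where remainder 1 gives e = v - n instead
    of e + 1.\<close>
  have "config_ideal n \<l> C = symbolic_power n \<l> C 1"
    using assms(5,7) by (intro symbolic_power_1[symmetric, of v]) (auto simp: proper_hyperplanes_def)
  then show ?thesis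
    using alpha[of _ 0] alpha[of 1 0] alpha[of 0 1] alpha n e by auto
qed

end
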